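(* The numerical GCD solves the numerical GCD problem. More specifically: for every polynomial pair $(\hat p,\hat q)\in\mathcal{P}_{m,n}$, with $k=\deg\gcd(\hat p,\hat q)$, there are a neighborhood $\mathcal{D}\subset\mathcal{P}_{m,n}$ of $(\hat p,\hat q)$ in $P_{m,n}$ and a constant $\theta>0$ such that, for every $(p,q)\in\mathcal{D}$ and $\varepsilon\in(\|(p,q)-(\hat p,\hat q)\|,\theta)$, the numerical GCD $\gcd_\varepsilon(p,q)$ exists, is unique as a $\sim$-equivalence class, and satisfies the following properties. (iv) (Identical degrees) $\deg(\gcd_\varepsilon(p,q))=\deg(\gcd(\hat p,\hat q))=k$. (v) (Convergence) For each fixed $\varepsilon\in(0,\theta)$, $\displaystyle\lim_{(p,q)\to(\hat p,\hat q)}\gcd\nolimits_\varepsilon(p,q)=\gcd(\hat p,\hat q)$. (vi) (Bounded sensitivity) For each fixed $\varepsilon\in(0,\theta)$, $$\limsup_{(p,q)\to(\hat p,\hat q)}\ \frac{\displaystyle\inf_{u\in\gcd_\varepsilon(p,q),\ \hat u\in\gcd(\hat p,\hat q)}\|(u,v,w)-(\hat u,\hat v,\hat w)\|}{\|(p,q)-(\hat p,\hat q)\|}\ \le\ \inf_{\substack{\mathbf h\in\mathbb{C}^{k+1},\ \hat u\in\gcd(\hat p,\hat q)\\ (\hat u\hat v,\hat u\hat w)=(\hat p,\hat q)}}\big\|J_{\mathbf h}(\hat u,\hat v,\hat w)^+\big\|\ <\ \infty,$$ where $(v,w)$ is the cofactor pair of the numerical GCD $u$ of $(p,q)$, and $(\hat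 v,\hat w)=(\hat p/\hat u,\hat q/\hat u)$ is the cofactor pair of $(\hat p,\hat q)$ associated with $\hat u$.
   Context: All polynomials are in $\mathbb{C}[x]$, one variable. $P_n$ is the vector space of polynomials of degree at most $n$; a polynomial $p=\rho_0+\cdots+\rho_nx^n\in P_n$ has coefficient vector $[\rho_0;\dots;\rho_n]\in\mathbb{C}^{n+1}$; $\|p\|$ is the Euclidean norm of the coefficient vector, and $\|(p_1,\dots,p_l)\|=\sqrt{\|p_1\|^2+\cdots+\|p_l\|^2}$. $P_{m,n}=P_m\times P_n$ and $\mathcal{P}_{m,n}=\{(p,q)\in P_{m,n} : \deg p=m,\ \deg q=n\}$. A GCD of $(p,q)$ is any polynomial of highest degree dividing both (not necessarily monic); $\gcd(p,q)$ denotes the set of all GCDs, one equivalence class for the relation $f\sim g\iff f=\alpha g$ for some constant $\alpha\neq0$. For $0\le k\le\min\{m,n\}$, $\mathcal{P}^k_{m,n}=\{(p,q)\in\mathcal{P}_{m,n} : \deg\gcd(p,q)=k\}$ and $\theta_k(p,q)=\inf\{\|(p,q)-(r,s)\| : (r,s)\in\mathcal{P}^k_{m,n}\}$. Numerical GCD: let $(p,q)\in\mathcal{P}_{m,n}$ and $\varepsilon>0$, and let $k=\max\{j : \theta_j(p,q)<\varepsilon\}$. A numerical GCD of $(p,q)$ within $\varepsilon$ is an exact GCD $u$ of a pair $(\tilde p,\tilde q)\in\mathcal{P}^k_{m,n}$ with $\|(\tilde p,\tilde q)-(p,q)\|=\theta_k(p,q)$. The $\sim$-class of numerical GCDs is denoted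 $\gcd_\varepsilon(p,q)=\gcd(\tilde p,\tilde q)$. The cofactor pair of a numerical GCD $u$ is $(v,w)=(\tilde p/u,\tilde q/u)$. Numerical GCD problem: given a pair $(p,q)$ that is a small perturbation of an underlying pair $(\hat p,\hat q)$, find a polynomial $u$ of degree equal to $\deg\gcd(\hat p,\hat q)$ with accuracy $\inf_{\hat u\in\gcd(\hat p,\hat q)}\|u-\hat u\|=O(\|(p,q)-(\hat p,\hat q)\|)$. The limit of $\sim$-classes in (v) is taken in the quotient by $\sim$: for $\hat u\in\gcd(\hat p,\hat q)$ one can choose representatives $u\in\gcd_\varepsilon(p,q)$ with $u\to\hat u$ in $P_k$. For $f=\phi_0+\cdots+\phi_lx^l\in P_l$, $C_j(f)$ is the $(l+j+1)\times(j+1)$ convolution matrix of the linear map $P_j\to P_{l+j}$, $g\mapsto fg$, in the monomial bases. For $u\in P_k$, $v\in P_{m-k}$, $w\in P_{n-k}$ and $\mathbf h\in\mathbb{C}^{k+1}$, $$J_{\mathbf h}(u,v,w)=\begin{bmatrix}\mathbf h^{\mathsf H}&0&0\\ C_k(v)&C_{m-k}(u)&0\\ C_k(w)&0&C_{n-k}(u)\end{bmatrix},$$ where $\mathsf H$ denotes conjugate transpose. For an injective matrix $A$, $A^+=(A^{\mathsf H}A)^{-1}A^{\mathsf H}$; matrix norms are induced by the Euclidean vector norm. The infimum on the right of (vi) is over those $\mathbf h$ for which $J_{\mathbf h}(\hat u,\hat v,\hat w)$ is injective, so that $J^+_{\mathbf h}$ is defined. *)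

theory Defs
  imports
    "HOL-Computational_Algebra.Polynomial"
    "HOL-Library.Extended_Real"
    "HOL-Library.Product_Plus"
    "HOL-Library.Landau_Symbols"
    "Jordan_Normal_Form.Gauss_Jordan_Elimination"
    "Jordan_Normal_Form.Schur_Decomposition"
begin

type_synonym cpoly = "complex poly"

section \<open>Norms of coefficient vectors\<close>

definition poly_norm :: "cpoly \<Rightarrow> real" where
  "poly_norm p = sqrt (\<Sum>i\<le>degree p. (cmod (coeff p i))\<^sup>2)"

definition pair_norm :: "cpoly \<times> cpoly \<Rightarrow> real" where
  "pair_norm = (\<lambda>(p, q). sqrt ((poly_norm p)\<^sup>2 + (poly_norm q)\<^sup>2))"

definition triple_norm :: "cpoly \<times> cpoly \<times> cpoly \<Rightarrow> real" where
  "triple_norm = (\<lambda>(u, v, w). sqrt ((poly_norm u)\<^sup>2 + (poly_norm v)\<^sup>2 + (poly_norm w)\<^sup>2))"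

section \<open>Polynomial pairs and exact GCDs\<close>

definition pairs_upto :: "nat \<Rightarrow> nat \<Rightarrow> (cpoly \<times> cpoly) set" where
  "pairs_upto m n = {(p, q). degree p \<le> m \<and> degree q \<le> n}"

text \<open>The zero polynomial, to which HOL assigns degree 0, is not a polynomial of degree 0
  in the mathematical sense and must be excluded explicitly.\<close>

definition pairs_exact :: "nat \<Rightarrow> nat \<Rightarrow> (cpoly \<times> cpoly) set" where
  "pairs_exact m n = {(p, q). p \<noteq> 0 \<and> degree p = m \<and> q \<noteq> 0 \<and> degree q = n}"

definition gcds :: "cpoly \<times> cpoly \<Rightarrow> cpoly set" where
  "gcds = (\<lambda>(p, q). {u. u dvd p \<and> u dvd q \<and>
                       (\<forall>d. d dvd p \<and> d dvd q \<longrightarrow> degree d \<le> degree u)})"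

definition poly_sim :: "cpoly \<Rightarrow> cpoly \<Rightarrow> bool"  (infix \<open>\<sim>\<^sub>p\<close> 50) where
  "f \<sim>\<^sub>p g \<longleftrightarrow> (\<exists>a. a \<noteq> 0 \<and> f = smult a g)"

text \<open>The degree of a class of polynomials that all have the same degree.\<close>

definition class_has_degree :: "cpoly set \<Rightarrow> nat \<Rightarrow> bool" where
  "class_has_degree G k \<longleftrightarrow> degree ` G = {k}"

definition pairs_gcd_degree :: "nat \<Rightarrow> nat \<Rightarrow> nat \<Rightarrow> (cpoly \<times> cpoly) set" where
  "pairs_gcd_degree m n k = {pq \<in> pairs_exact m n. class_has_degree (gcds pq) k}"

text \<open>A GCD together with its cofactor pair.\<close>

definition gcd_triples :: "cpoly \<times> cpoly \<Rightarrow> (cpoly \<times> cpoly \<times> cpoly) set" where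
  "gcd_triples pq = {(u, v, w). u \<in> gcds pq \<and> (u * v, u * w) = pq}"

section \<open>Numerical GCDs\<close>

definition gcd_dist :: "nat \<Rightarrow> nat \<Rightarrow> nat \<Rightarrow> cpoly \<times> cpoly \<Rightarrow> real" where
  "gcd_dist m n k pq = (INF rs \<in> pairs_gcd_degree m n k. pair_norm (pq - rs))"

text \<open>The bound on \<open>j\<close> is part of the notion: for \<open>j > min m n\<close> the infimum defining
  \<^const>\<open>gcd_dist\<close> would range over the empty set.\<close>

definition num_gcd_degree :: "nat \<Rightarrow> nat \<Rightarrow> real \<Rightarrow> cpoly \<times> cpoly \<Rightarrow> nat" where
  "num_gcd_degree m n \<epsilon> pq = Max {j. j \<le> min m n \<and> gcd_dist m n j pq < \<epsilon>}"

definition nearest_pairs :: "nat \<Rightarrow> nat \<Rightarrow> real \<Rightarrow> cpoly \<times> cpoly \<Rightarrow> (cpoly \<times> cpoly) set" where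
  "nearest_pairs m n \<epsilon> pq =
     (let k = num_gcd_degree m n \<epsilon> pq
      in {rs \<in> pairs_gcd_degree m n k. pair_norm (rs - pq) = gcd_dist m n k pq})"

definition num_gcds :: "nat \<Rightarrow> nat \<Rightarrow> real \<Rightarrow> cpoly \<times> cpoly \<Rightarrow> cpoly set" where
  "num_gcds m n \<epsilon> pq = (\<Union>rs \<in> nearest_pairs m n \<epsilon> pq. gcds rs)"

definition num_gcd_triples ::
    "nat \<Rightarrow> nat \<Rightarrow> real \<Rightarrow> cpoly \<times> cpoly \<Rightarrow> (cpoly \<times> cpoly \<times> cpoly) set" where
  "num_gcd_triples m n \<epsilon> pq = (\<Union>rs \<in> nearest_pairs m n \<epsilon> pq. gcd_triples rs)"

section \<open>Neighborhoods and limits of pairs\<close>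

definition pair_nbhd :: "nat \<Rightarrow> nat \<Rightarrow> cpoly \<times> cpoly \<Rightarrow> (cpoly \<times> cpoly) set \<Rightarrow> bool" where
  "pair_nbhd m n pq0 D \<longleftrightarrow>
     (\<exists>r>0. {pq \<in> pairs_upto m n. pair_norm (pq - pq0) < r} \<subseteq> D)"

text \<open>The filter of \<open>(p, q) \<rightarrow> pq0\<close> with \<open>(p, q) \<noteq> pq0\<close>. Restricting it to pairs of exact
  degrees would not change it when \<open>pq0\<close> has exact degrees.\<close>

definition pair_at :: "nat \<Rightarrow> nat \<Rightarrow> cpoly \<times> cpoly \<Rightarrow> (cpoly \<times> cpoly) filter" where
  "pair_at m n pq0 =
     (INF r \<in> {0<..}. principal {pq \<in> pairs_upto m n.
                                   0 < pair_norm (pq - pq0) \<and> pair_norm (pq - pq0) < r})"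

text \<open>\<open>U\<close> assigns to the data \<open>(p, q)\<close> a computed polynomial. Classes of GCDs are closed under
  nonzero scaling, so the accuracy estimate is to be expected only of selections \<open>U\<close> that stay
  bounded near \<open>pq0\<close>; multiplying \<open>U\<close> by unbounded scalars would multiply the error.\<close>

definition solves_num_gcd_problem ::
    "nat \<Rightarrow> nat \<Rightarrow> cpoly \<times> cpoly \<Rightarrow> (cpoly \<times> cpoly \<Rightarrow> cpoly) \<Rightarrow> bool" where
  "solves_num_gcd_problem m n pq0 U \<longleftrightarrow>
     (\<forall>\<^sub>F pq in pair_at m n pq0. class_has_degree (gcds pq0) (degree (U pq))) \<and>
     (\<lambda>pq. INF u0 \<in> gcds pq0. poly_norm (U pq - u0))
       \<in> O[pair_at m n pq0](\<lambda>pq. pair_norm (pq - pq0))"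

section \<open>Convolution matrices and the matrix \<open>J\<close>\<close>

definition conv_mat :: "nat \<Rightarrow> nat \<Rightarrow> cpoly \<Rightarrow> complex mat" where
  "conv_mat l j f = mat (l + j + 1) (j + 1) (\<lambda>(r, c). coeff (f * monom 1 c) r)"

definition J_mat ::
    "nat \<Rightarrow> nat \<Rightarrow> nat \<Rightarrow> complex vec \<Rightarrow> cpoly \<Rightarrow> cpoly \<Rightarrow> cpoly \<Rightarrow> complex mat" where
  "J_mat m n k h u v w =
     four_block_mat
       (mat_of_row (conjugate h))  (0\<^sub>m 1 ((m - k + 1) + (n - k + 1)))
       (conv_mat (m - k) k v @\<^sub>r conv_mat (n - k) k w)
         (four_block_mat
            (conv_mat k (m - k) u)        (0\<^sub>m (m + 1) (n - k + 1))
            (0\<^sub>m (n + 1) (m - k + 1))     (conv_mat k (n - k) u))"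

definition mat_injective :: "complex mat \<Rightarrow> bool" where
  "mat_injective A \<longleftrightarrow> inj_on (\<lambda>x. A *\<^sub>v x) (carrier_vec (dim_col A))"

text \<open>Meaningful for injective \<open>A\<close> only, where the inverse exists.\<close>

definition pseudo_inverse :: "complex mat \<Rightarrow> complex mat" where
  "pseudo_inverse A = the (mat_inverse (mat_adjoint A * A)) * mat_adjoint A"

definition euclid_norm :: "complex vec \<Rightarrow> real" where
  "euclid_norm x = sqrt (\<Sum>i<dim_vec x. (cmod (x $ i))\<^sup>2)"

definition mat_norm :: "complex mat \<Rightarrow> real" where
  "mat_norm A =
     (SUP x \<in> {x \<in> carrier_vec (dim_col A). euclid_norm x = 1}. euclid_norm (A *\<^sub>v x))"

end

theory Submission
  imports Defs "HOL-Analysis.L2_Norm" "HOL-Computational_Algebra.Field_as_Ring"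
    "HOL-Computational_Algebra.Polynomial_Factorial"
begin

text \<open>
  Write \<open>z = (u, v, w)\<close> and \<open>F z = (u v, u w)\<close>.  The pairs of degrees \<open>m\<close>, \<open>n\<close> whose GCD has degree \<open>k\<close> are
  parametrized by \<open>F\<close>, with one redundant parameter for the scaling of \<open>u\<close>.  Fixing the value of
  \<open>h\<^sup>H u\<close> removes it, and \<open>J\<close> is the Jacobian of the normalized parametrization.  Everything follows from the
  statement that, near \<open>pq0\<close>, this set behaves like a submanifold and the numerical GCD is given
  by the projection onto it.

  As \<open>F\<close> is quadratic, \<open>F (z + x) = F z + F' z x + F x\<close> holds exactly.  Injectivity
  of \<open>J\<close> yields \<open>\<parallel>x\<parallel> \<le> \<parallel>J\<^sup>+\<parallel> \<parallel>F' z0 x\<parallel>\<close> on the directions \<open>x\<close> whose first component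
  \<open>h\<^sup>H\<close> annihilates, and by perturbation a
  Lipschitz inverse of \<open>F\<close> on a small ball.  Two facts come from compactness, since cofactors of a
  normalized divisor stay bounded: the GCD degree cannot increase under a small perturbation
  (\<open>gcd_degree_upper_semicontinuous\<close>), and pairs near \<open>pq0\<close> with a GCD of degree \<open>k\<close> have factorizations near the
  given one (\<open>nearby_pairs_factor_nearby\<close>).  The first fact provides \<open>\<theta>\<close> and shows that the numerical GCD has
  degree \<open>k\<close>; the second reduces the search for a nearest pair to a small ball of factorizations.

  A nearest pair exists by compactness.  Two nearest pairs would have factorizations whose midpoint
  gives a pair closer by a quadratic amount, because \<open>F\<close> is almost affine on the segment between them
  (\<open>nearest_pair_unique\<close>).  For the sensitivity, let \<open>\<delta>\<close> be the distance of \<open>pq\<close> to \<open>pq0\<close> and let \<open>F z\<close> be the nearest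
  pair.  Comparing \<open>F z\<close> with the pairs on the path from \<open>F z\<close> to \<open>pq0 = F z0\<close> shows that
  the distance of \<open>F z\<close> to \<open>pq0\<close> is at most \<open>\<delta> + O(\<delta>\<^sup>2)\<close>, as for an orthogonal projection.  Hence
  \<open>\<parallel>z - z0\<parallel> \<le> \<parallel>J\<^sup>+\<parallel> \<delta> + O(\<delta>\<^sup>2)\<close> (\<open>nearest_pair_sensitivity\<close>), which gives convergence, accuracy and
  the bound on the limit superior for each admissible \<open>h\<close> and each factorization of \<open>pq0\<close>.  That bound is finite
  because \<open>J\<close> is injective if \<open>h\<close> is the coefficient vector of \<open>u0\<close> (\<open>J_mat_injective\<close>).
\<close>

section \<open>Euclidean norms of coefficient vectors\<close>

lemma poly_norm_eq_L2_set:
  assumes "degree p \<le> N"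
  shows "poly_norm p = L2_set (\<lambda>i. cmod (coeff p i)) {..N}"
proof -
  have "(\<Sum>i\<le>degree p. (cmod (coeff p i))\<^sup>2) = (\<Sum>i\<le>N. (cmod (coeff p i))\<^sup>2)"
    by (rule sum.mono_neutral_left) (use assms in \<open>auto simp: coeff_eq_0\<close>)
  then show ?thesis
    by (simp add: poly_norm_def L2_set_def)
qed

lemma poly_norm_nonneg [simp]: "0 \<le> poly_norm p"
  by (simp add: poly_norm_def sum_nonneg)

lemma poly_norm_zero [simp]: "poly_norm 0 = 0"
  by (simp add: poly_norm_def)

lemma norm_coeff_le_poly_norm: "cmod (coeff p i) \<le> poly_norm p"
proof (cases "i \<le> degree p")
  case True
  then show ?thesis
    using member_le_L2_set[of "{..degree p}" i "\<lambda>i. cmod (coeff p i)"]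
    by (simp add: poly_norm_eq_L2_set[OF order_refl])
qed (simp add: coeff_eq_0)

lemma poly_norm_eq_0_iff [simp]: "poly_norm p = 0 \<longleftrightarrow> p = 0"
  using norm_coeff_le_poly_norm[of p] by (force simp: poly_eq_iff poly_norm_def)

lemma poly_norm_triangle: "poly_norm (p + q) \<le> poly_norm p + poly_norm q"
proof -
  define N where "N = max (degree p) (degree q)"
  have deg: "degree p \<le> N" "degree q \<le> N" "degree (p + q) \<le> N"
    unfolding N_def using degree_add_le_max by auto
  have "poly_norm (p + q) \<le> L2_set (\<lambda>i. cmod (coeff p i) + cmod (coeff q i)) {..N}"
    unfolding poly_norm_eq_L2_set[OF deg(3)] by (intro L2_set_mono) (auto intro: norm_triangle_ineq)
  also have "\<dots> \<le> poly_norm p + poly_norm q"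
    unfolding poly_norm_eq_L2_set[OF deg(1)] poly_norm_eq_L2_set[OF deg(2)]
    by (rule L2_set_triangle_ineq)
  finally show ?thesis .
qed

lemma poly_norm_smult: "poly_norm (smult c p) = cmod c * poly_norm p"
proof -
  have "poly_norm (smult c p) = L2_set (\<lambda>i. cmod c * cmod (coeff p i)) {..degree p}"
    by (subst poly_norm_eq_L2_set[OF degree_smult_le]) (simp add: norm_mult)
  then show ?thesis
    by (simp add: L2_set_right_distrib poly_norm_eq_L2_set[OF order_refl])
qed

lemma poly_norm_uminus [simp]: "poly_norm (- p) = poly_norm p"
  using poly_norm_smult[of "-1" p] by simp

lemma poly_norm_le_sum:
  assumes "degree p \<le> N"
  shows "poly_norm p \<le> (\<Sum>i\<le>N. cmod (coeff p i))"
  unfolding poly_norm_eq_L2_set[OF assms] by (rule L2_set_le_sum) auto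

lemma poly_norm_sum_le: "poly_norm (sum f A) \<le> (\<Sum>i\<in>A. poly_norm (f i))"
  by (induction A rule: infinite_finite_induct)
     (auto intro: order_trans[OF poly_norm_triangle] add_left_mono)

text \<open>Multiplication by a power of the variable only shifts the coefficients.\<close>

lemma poly_norm_monom_mult: "poly_norm (monom 1 i * q) = poly_norm q"
proof (cases "q = 0")
  case False
  have "(poly_norm (monom 1 i * q))\<^sup>2 = (\<Sum>j\<le>i + degree q. (cmod (coeff (monom 1 i * q) j))\<^sup>2)"
    using False by (simp add: poly_norm_def degree_mult_eq degree_monom_eq sum_nonneg)
  also have "\<dots> = (\<Sum>j\<in>{i..i + degree q}. (cmod (coeff (monom 1 i * q) j))\<^sup>2)"
    by (rule sum.mono_neutral_right) (auto simp: coeff_monom_mult)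
  also have "\<dots> = (\<Sum>j\<le>degree q. (cmod (coeff q j))\<^sup>2)"
    by (rule sum.reindex_bij_witness[of _ "\<lambda>j. j + i" "\<lambda>j. j - i"])
       (auto simp: coeff_monom_mult)
  also have "\<dots> = (poly_norm q)\<^sup>2"
    by (simp add: poly_norm_def sum_nonneg)
  finally show ?thesis
    by (simp add: power2_eq_iff_nonneg)
qed simp

text \<open>Expanding one factor into monomials bounds the norm of the product by the sum of the moduli
  of its at most \<open>N + 1\<close> coefficients.  The crude constant suffices, because
  it only influences second-order terms and the size of neighborhoods.\<close>

lemma poly_norm_mult_le:
  assumes "degree p \<le> N"
  shows "poly_norm (p * q) \<le> real (N + 1) * poly_norm p * poly_norm q"
proof -
  have p: "p = (\<Sum>i\<le>N. monom (coeff p i) i)"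
    using assms by (simp add: poly_as_sum_of_monoms')
  have "p * q = (\<Sum>i\<le>N. smult (coeff p i) (monom 1 i * q))"
    by (subst p) (simp add: sum_distrib_right smult_monom flip: mult_smult_left)
  also have "poly_norm \<dots> \<le> (\<Sum>i\<le>N. cmod (coeff p i) * poly_norm q)"
    by (rule order_trans[OF poly_norm_sum_le]) (simp add: poly_norm_smult poly_norm_monom_mult)
  also have "\<dots> \<le> (\<Sum>i\<le>N. poly_norm p * poly_norm q)"
    by (intro sum_mono mult_right_mono norm_coeff_le_poly_norm) auto
  finally show ?thesis
    by (simp add: algebra_simps)
qed

text \<open>Stewart's identity expresses the distance from a point of a segment to the origin through
  the distances of the end points.  It replaces inner products and orthogonality in all arguments
  about nearest points below.\<close>

lemma cmod_Stewart:
  "(cmod (of_real (1 - t) * a + of_real t * b))\<^sup>2 =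
     (1 - t) * (cmod a)\<^sup>2 + t * (cmod b)\<^sup>2 - t * (1 - t) * (cmod (a - b))\<^sup>2"
  unfolding cmod_power2 by (simp add: power2_eq_square algebra_simps)

lemma poly_norm_Stewart:
  "(poly_norm (smult (of_real (1 - t)) a + smult (of_real t) b))\<^sup>2 =
     (1 - t) * (poly_norm a)\<^sup>2 + t * (poly_norm b)\<^sup>2 - t * (1 - t) * (poly_norm (a - b))\<^sup>2"
proof -
  define N where "N = max (degree a) (degree b)"
  have sq: "(poly_norm p)\<^sup>2 = (\<Sum>i\<le>N. (cmod (coeff p i))\<^sup>2)" if "degree p \<le> N" for p
    using that by (simp add: poly_norm_eq_L2_set L2_set_def sum_nonneg)
  have deg: "degree a \<le> N" "degree b \<le> N" "degree (a - b) \<le> N"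
    unfolding N_def using degree_diff_le_max by auto
  have deg': "degree (smult (of_real (1 - t)) a + smult (of_real t) b) \<le> N"
    by (intro degree_add_le order_trans[OF degree_smult_le] deg)
  show ?thesis
    unfolding sq[OF deg'] sq[OF deg(1)] sq[OF deg(2)] sq[OF deg(3)]
    by (simp only: coeff_add coeff_smult coeff_diff cmod_Stewart sum.distrib sum_subtractf sum_distrib_left)
qed

lemma pair_norm_Pair: "pair_norm (p, q) = sqrt ((poly_norm p)\<^sup>2 + (poly_norm q)\<^sup>2)"
  by (simp add: pair_norm_def)

lemma pair_norm_nonneg [simp]: "0 \<le> pair_norm x"
  by (cases x) (simp add: pair_norm_Pair)

lemma pair_norm_eq_0_iff [simp]: "pair_norm x = 0 \<longleftrightarrow> x = 0"
  by (cases x) (simp add: pair_norm_Pair sum_power2_eq_zero_iff zero_prod_def)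

lemma pair_norm_uminus [simp]: "pair_norm (- x) = pair_norm x"
  by (cases x) (simp add: pair_norm_Pair)

lemma pair_norm_minus_commute: "pair_norm (x - y) = pair_norm (y - x)"
  using pair_norm_uminus[of "x - y"] by simp

lemma pair_norm_triangle: "pair_norm (x + y) \<le> pair_norm x + pair_norm y"
proof (cases x; cases y)
  fix a b c d assume xy: "x = (a, b)" "y = (c, d)"
  have "pair_norm (x + y) \<le> sqrt ((poly_norm a + poly_norm c)\<^sup>2 + (poly_norm b + poly_norm d)\<^sup>2)"
    unfolding xy by (auto simp: pair_norm_Pair intro!: add_mono power_mono poly_norm_triangle)
  also have "\<dots> \<le> pair_norm x + pair_norm y"
    unfolding xy pair_norm_Pair by (rule real_sqrt_sum_squares_triangle_ineq)
  finally show ?thesis .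
qed

lemma pair_norm_diff_triangle: "pair_norm (x - z) \<le> pair_norm (x - y) + pair_norm (y - z)"
  using pair_norm_triangle[of "x - y" "y - z"] by simp

lemma pair_norm_diff_le: "pair_norm (x - y) \<le> pair_norm x + pair_norm y"
  using pair_norm_triangle[of x "- y"] by simp

lemma poly_norm_fst_le: "poly_norm (fst x) \<le> pair_norm x"
  by (cases x) (simp add: pair_norm_Pair real_le_rsqrt)

lemma poly_norm_snd_le: "poly_norm (snd x) \<le> pair_norm x"
  by (cases x) (simp add: pair_norm_Pair real_le_rsqrt)

lemma pair_norm_le_add: "pair_norm x \<le> poly_norm (fst x) + poly_norm (snd x)"
  by (cases x) (simp add: pair_norm_Pair sqrt_sum_squares_le_sum)

definition pair_scale :: "real \<Rightarrow> cpoly \<times> cpoly \<Rightarrow> cpoly \<times> cpoly" where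
  "pair_scale t = map_prod (smult (of_real t)) (smult (of_real t))"

lemma pair_norm_scale: "pair_norm (pair_scale t x) = \<bar>t\<bar> * pair_norm x"
  by (cases x) (simp add: pair_scale_def pair_norm_Pair poly_norm_smult power_mult_distrib
      real_sqrt_mult flip: distrib_left)

lemma pair_norm_Stewart:
  "(pair_norm (pair_scale (1 - t) a + pair_scale t b))\<^sup>2 =
     (1 - t) * (pair_norm a)\<^sup>2 + t * (pair_norm b)\<^sup>2 - t * (1 - t) * (pair_norm (a - b))\<^sup>2"
proof (cases a; cases b)
  fix a1 a2 b1 b2 assume "a = (a1, a2)" "b = (b1, b2)"
  then show ?thesis
    using poly_norm_Stewart[of t a1 b1] poly_norm_Stewart[of t a2 b2]
    by (simp add: pair_norm_Pair pair_scale_def algebra_simps)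
qed

lemma triple_norm_eq: "triple_norm (u, v, w) = sqrt ((poly_norm u)\<^sup>2 + (pair_norm (v, w))\<^sup>2)"
  by (simp add: triple_norm_def pair_norm_Pair)

lemma triple_norm_nonneg [simp]: "0 \<le> triple_norm x"
  by (cases x) (simp add: triple_norm_eq)

lemma triple_norm_uminus [simp]: "triple_norm (- x) = triple_norm x"
  by (cases x) (simp add: triple_norm_def)

lemma triple_norm_eq_0_iff [simp]: "triple_norm x = 0 \<longleftrightarrow> x = 0"
  by (cases x) (simp add: triple_norm_eq sum_power2_eq_zero_iff zero_prod_def)

lemma triple_norm_zero [simp]: "triple_norm 0 = 0"
  by simp

lemma triple_norm_minus_commute: "triple_norm (x - y) = triple_norm (y - x)"
  using triple_norm_uminus[of "x - y"] by simp

lemma triple_norm_triangle: "triple_norm (x + y) \<le> triple_norm x + triple_norm y"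
proof (cases x; cases y)
  fix a b c d assume xy: "x = (a, b)" "y = (c, d)"
  have eq: "triple_norm (u, b) = sqrt ((poly_norm u)\<^sup>2 + (pair_norm b)\<^sup>2)" for u b
    by (cases b) (simp only: triple_norm_eq)
  have "triple_norm (x + y) \<le> sqrt ((poly_norm a + poly_norm c)\<^sup>2 + (pair_norm b + pair_norm d)\<^sup>2)"
    unfolding xy
    by (auto simp: eq intro!: add_mono power_mono poly_norm_triangle pair_norm_triangle)
  also have "\<dots> \<le> triple_norm x + triple_norm y"
    unfolding xy eq by (rule real_sqrt_sum_squares_triangle_ineq)
  finally show ?thesis .
qed

lemma triple_norm_diff_triangle: "triple_norm (x - z) \<le> triple_norm (x - y) + triple_norm (y - z)"
  using triple_norm_triangle[of "x - y" "y - z"] by simp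

lemma poly_norm_le_triple_norm: "poly_norm u \<le> triple_norm (u, vw)"
  by (cases vw) (simp add: triple_norm_eq real_le_rsqrt)

lemma pair_norm_le_triple_norm: "pair_norm vw \<le> triple_norm (u, vw)"
  by (cases vw) (simp add: triple_norm_eq real_le_rsqrt)

lemma poly_norm_fst_le_triple_norm: "poly_norm (fst x) \<le> triple_norm x"
  by (cases x) (simp add: poly_norm_le_triple_norm)

lemma triple_norm_le_add: "triple_norm (u, v, w) \<le> poly_norm u + poly_norm v + poly_norm w"
proof -
  have "triple_norm (u, v, w) \<le> poly_norm u + pair_norm (v, w)"
    by (simp add: triple_norm_eq sqrt_sum_squares_le_sum)
  then show ?thesis
    using pair_norm_le_add[of "(v, w)"] by simp
qed

definition triple_scale :: "real \<Rightarrow> cpoly \<times> cpoly \<times> cpoly \<Rightarrow> cpoly \<times> cpoly \<times> cpoly" where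
  "triple_scale t = map_prod (smult (of_real t)) (pair_scale t)"

lemma triple_norm_scale: "triple_norm (triple_scale t x) = \<bar>t\<bar> * triple_norm x"
  by (cases x) (simp add: triple_scale_def pair_scale_def triple_norm_def poly_norm_smult
      power_mult_distrib real_sqrt_mult flip: distrib_left)

section \<open>Classes of exact GCDs\<close>

text \<open>A common divisor of highest degree divides \<open>gcd p q\<close>, and the quotient has degree 0,
  so maximality of the degree characterizes the GCDs up to a nonzero constant factor.\<close>

lemma gcds_eq_sim_class:
  assumes "p \<noteq> 0"
  shows "gcds (p, q) = {u. u \<sim>\<^sub>p gcd p q}"
proof (intro equalityI subsetI CollectI; (drule CollectD)?)
  fix u assume "u \<in> gcds (p, q)"
  then have u: "u dvd gcd p q" and max: "degree (gcd p q) \<le> degree u"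
    by (auto simp: gcds_def)
  from u obtain c where c: "gcd p q = u * c" ..
  with assms have nz: "u \<noteq> 0" "c \<noteq> 0"
    by auto
  with max c have "degree c = 0"
    by (simp add: degree_mult_eq)
  then obtain a where a: "c = [:a:]"
    by (rule degree_eq_zeroE)
  with nz c have "u = smult (1 / a) (gcd p q)" "1 / a \<noteq> 0"
    by auto
  then show "u \<sim>\<^sub>p gcd p q"
    unfolding poly_sim_def by blast
next
  fix u assume "u \<sim>\<^sub>p gcd p q"
  then obtain a where "a \<noteq> 0" "u = smult a (gcd p q)"
    by (auto simp: poly_sim_def)
  then show "u \<in> gcds (p, q)"
    using assms by (auto simp: gcds_def smult_dvd_iff intro!: dvd_imp_degree_le)
qed

lemma in_gcds_iff:
  assumes "p \<noteq> 0"
  shows "u \<in> gcds (p, q) \<longleftrightarrow> u dvd p \<and> u dvd q \<and> degree u = degree (gcd p q)"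
proof
  assume "u \<in> gcds (p, q)"
  with assms gcds_eq_sim_class[OF assms] show "u dvd p \<and> u dvd q \<and> degree u = degree (gcd p q)"
    by (auto simp: gcds_def poly_sim_def)
next
  assume "u dvd p \<and> u dvd q \<and> degree u = degree (gcd p q)"
  with assms show "u \<in> gcds (p, q)"
    by (auto simp: gcds_def intro!: dvd_imp_degree_le)
qed

lemma class_has_degree_gcds_iff:
  assumes "p \<noteq> 0"
  shows "class_has_degree (gcds (p, q)) k \<longleftrightarrow> degree (gcd p q) = k"
proof -
  have "gcd p q \<in> gcds (p, q)"
    using assms by (simp add: in_gcds_iff)
  then have "degree ` gcds (p, q) = {degree (gcd p q)}"
    using assms by (auto simp: in_gcds_iff)
  then show ?thesis
    by (simp add: class_has_degree_def)
qed

lemma poly_sim_sym: "u \<sim>\<^sub>p v \<Longrightarrow> v \<sim>\<^sub>p u"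
  unfolding poly_sim_def by (metis divide_self_if smult_1_left smult_smult times_divide_eq_left mult_1 divide_eq_0_iff one_neq_zero)

lemma poly_sim_trans: "u \<sim>\<^sub>p v \<Longrightarrow> v \<sim>\<^sub>p w \<Longrightarrow> u \<sim>\<^sub>p w"
  unfolding poly_sim_def by (metis mult_eq_0_iff smult_smult)

lemma gcds_eq_class_of_member:
  assumes "u \<in> gcds pq" "fst pq \<noteq> 0"
  shows "gcds pq = {u'. u' \<sim>\<^sub>p u}"
  using assms by (cases pq) (auto simp: gcds_eq_sim_class intro: poly_sim_trans poly_sim_sym)

lemma pairs_gcd_degree_iff:
  "(p, q) \<in> pairs_gcd_degree m n k \<longleftrightarrow>
     p \<noteq> 0 \<and> q \<noteq> 0 \<and> degree p = m \<and> degree q = n \<and> degree (gcd p q) = k"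
  by (auto simp: pairs_gcd_degree_def pairs_exact_def class_has_degree_gcds_iff)

lemma pairs_gcd_degree_bound:
  assumes "pq \<in> pairs_gcd_degree m n k"
  shows "k \<le> m" "k \<le> n"
  using assms by (cases pq; auto simp: pairs_gcd_degree_iff intro!: dvd_imp_degree_le)+

text \<open>The pair \<open>x\<^sup>j x\<^bsup>m-j\<^esup>\<close> and \<open>x\<^sup>j (x - 1)\<^bsup>n-j\<^esup>\<close> serves as a witness.  Nonemptiness matters
  because a lower bound for \<^const>\<open>gcd_dist\<close> can only be read off from an infimum over a nonempty
  set.\<close>

lemma pairs_gcd_degree_nonempty:
  assumes "j \<le> m" "j \<le> n"
  shows "pairs_gcd_degree m n j \<noteq> {}"
proof -
  let ?a = "monom 1 (m - j) :: cpoly" and ?b = "[:-1, 1:] ^ (n - j) :: cpoly"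
  have "coprime [:0, 1::complex:] [:-1, 1:]"
  proof (rule coprimeI)
    fix c :: cpoly assume "c dvd [:0, 1:]" "c dvd [:-1, 1:]"
    then have "c dvd [:0, 1:] - [:-1, 1:]"
      by (rule dvd_diff)
    then show "is_unit c" by (simp add: one_pCons)
  qed
  then have "coprime ?a ?b"
    by (simp add: monom_altdef)
  then have "gcd (monom 1 j * ?a) (monom 1 j * ?b) = normalize (monom 1 j)"
    by (simp add: gcd_mult_left coprime_iff_gcd_eq_1)
  then have "degree (gcd (monom 1 j * ?a) (monom 1 j * ?b)) = j"
    by (simp add: degree_monom_eq)
  moreover have "degree (monom 1 j * ?a) = m" "degree (monom 1 j * ?b) = n"
    using assms by (simp_all add: degree_mult_eq degree_monom_eq degree_linear_power)
  ultimately have "(monom 1 j * ?a, monom 1 j * ?b) \<in> pairs_gcd_degree m n j"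
    by (simp add: pairs_gcd_degree_iff)
  then show ?thesis by blast
qed

lemma gcd_triples_exist:
  assumes "pq \<in> pairs_gcd_degree m n k" "u \<in> gcds pq"
  obtains v w where "(u, v, w) \<in> gcd_triples pq"
proof -
  obtain p q where pq: "pq = (p, q)" by (cases pq)
  with assms have "u dvd p" "u dvd q" by (auto simp: gcds_def)
  then show ?thesis
    using assms(2) by (auto simp: pq gcd_triples_def intro: that elim!: dvdE)
qed

lemma gcd_triples_degrees:
  assumes "pq \<in> pairs_gcd_degree m n k" "(u, v, w) \<in> gcd_triples pq"
  shows "degree u = k" "degree v = m - k" "degree w = n - k" "u \<noteq> 0" "v \<noteq> 0" "w \<noteq> 0"
proof -
  have pq: "pq = (u * v, u * w)" and u: "u \<in> gcds (u * v, u * w)"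
    using assms(2) by (auto simp: gcd_triples_def)
  have nz: "u * v \<noteq> 0" "u * w \<noteq> 0" and deg: "degree (u * v) = m" "degree (u * w) = n"
    and g: "degree (gcd (u * v) (u * w)) = k"
    using assms(1) unfolding pq pairs_gcd_degree_iff by auto
  show "u \<noteq> 0" "v \<noteq> 0" "w \<noteq> 0" using nz by auto
  show "degree u = k" using in_gcds_iff[OF nz(1)] u g by blast
  with deg nz show "degree v = m - k" "degree w = n - k"
    by (auto simp: degree_mult_eq)
qed

lemma gcd_triples_intro:
  assumes "(u * v, u * w) \<in> pairs_gcd_degree m n k" "degree u = k"
  shows "(u, v, w) \<in> gcd_triples (u * v, u * w)"
proof -
  have "u * v \<noteq> 0" "degree (gcd (u * v) (u * w)) = k"
    using assms(1) unfolding pairs_gcd_degree_iff by auto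
  then show ?thesis
    using assms(2) in_gcds_iff[of "u * v" u "u * w"] by (simp add: gcd_triples_def del: gcd_mult_left)
qed

section \<open>Compactness of polynomial factorizations\<close>

text \<open>For polynomials of bounded degree, convergence of every coefficient is convergence in the
  norm.  Phrasing it through coefficients makes products pass to the limit without estimates.\<close>

definition coeffs_tendsto :: "(nat \<Rightarrow> cpoly) \<Rightarrow> cpoly \<Rightarrow> bool" where
  "coeffs_tendsto f p \<longleftrightarrow> (\<forall>j. (\<lambda>i. coeff (f i) j) \<longlonglongrightarrow> coeff p j)"

lemma LIMSEQ_null_comparison:
  fixes f :: "nat \<Rightarrow> 'a::real_normed_vector"
  assumes "\<And>i. norm (f i) \<le> g i" "g \<longlonglongrightarrow> 0"
  shows "f \<longlonglongrightarrow> 0"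
  by (rule tendsto_norm_zero_cancel, rule tendsto_sandwich[OF _ _ tendsto_const assms(2)])
     (use assms(1) in auto)

lemma LIMSEQ_one_over_Suc: "(\<lambda>i. 1 / real (Suc i)) \<longlonglongrightarrow> 0"
  using LIMSEQ_inverse_real_of_nat by (simp add: inverse_eq_divide)

lemma coeffs_tendsto_mult:
  "coeffs_tendsto f p \<Longrightarrow> coeffs_tendsto g q \<Longrightarrow> coeffs_tendsto (\<lambda>i. f i * g i) (p * q)"
  unfolding coeffs_tendsto_def coeff_mult by (intro allI tendsto_sum tendsto_mult) auto

lemma coeffs_tendsto_smult:
  "c \<longlonglongrightarrow> a \<Longrightarrow> coeffs_tendsto g q \<Longrightarrow> coeffs_tendsto (\<lambda>i. smult (c i) (g i)) (smult a q)"
  unfolding coeffs_tendsto_def coeff_smult by (intro allI tendsto_mult) auto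

lemma coeffs_tendsto_unique: "coeffs_tendsto f p \<Longrightarrow> coeffs_tendsto f q \<Longrightarrow> p = q"
  unfolding coeffs_tendsto_def by (rule poly_eqI) (auto intro: LIMSEQ_unique)

lemma coeffs_tendsto_subseq:
  "coeffs_tendsto f p \<Longrightarrow> strict_mono \<sigma> \<Longrightarrow> coeffs_tendsto (\<lambda>i. f (\<sigma> i)) p"
  unfolding coeffs_tendsto_def using LIMSEQ_subseq_LIMSEQ[of "\<lambda>i. coeff (f i) _" _ \<sigma>] by (simp add: o_def)

lemma coeffs_tendsto_degree_le:
  assumes "coeffs_tendsto f p" "\<And>i. degree (f i) \<le> N"
  shows "degree p \<le> N"
proof (rule degree_le, intro allI impI)
  fix j assume "N < j"
  then have "coeff (f i) j = 0" for i
    using assms(2)[of i] by (simp add: coeff_eq_0)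
  with assms(1) have "(\<lambda>i. 0) \<longlonglongrightarrow> coeff p j"
    unfolding coeffs_tendsto_def by (auto dest!: spec[of _ j])
  then show "coeff p j = 0"
    by (simp add: LIMSEQ_const_iff)
qed

lemma coeffs_tendsto_poly_norm_diff:
  assumes "coeffs_tendsto f p" "\<And>i. degree (f i) \<le> N"
  shows "(\<lambda>i. poly_norm (f i - p)) \<longlonglongrightarrow> 0"
proof (rule tendsto_sandwich[of "\<lambda>_. 0" _ _ "\<lambda>i. \<Sum>j\<le>N. cmod (coeff (f i) j - coeff p j)"])
  have "degree p \<le> N"
    using coeffs_tendsto_degree_le[OF assms] .
  then have "degree (f i - p) \<le> N" for i
    using assms(2) by (simp add: degree_diff_le)
  from poly_norm_le_sum[OF this]
  show "\<forall>\<^sub>F i in sequentially. poly_norm (f i - p) \<le> (\<Sum>j\<le>N. cmod (coeff (f i) j - coeff p j))"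
    by simp
  have "(\<lambda>i. \<Sum>j\<le>N. cmod (coeff (f i) j - coeff p j)) \<longlonglongrightarrow> (\<Sum>j\<le>N. cmod (coeff p j - coeff p j))"
    using assms(1) unfolding coeffs_tendsto_def by (intro tendsto_intros) auto
  then show "(\<lambda>i. \<Sum>j\<le>N. cmod (coeff (f i) j - coeff p j)) \<longlonglongrightarrow> 0"
    by simp
qed auto

lemma coeffs_tendsto_poly_norm:
  assumes "coeffs_tendsto f p" "\<And>i. degree (f i) \<le> N"
  shows "(\<lambda>i. poly_norm (f i)) \<longlonglongrightarrow> poly_norm p"
proof (rule Lim_transform2[OF tendsto_const[of "poly_norm p"]])
  have "\<bar>poly_norm p - poly_norm (f i)\<bar> \<le> poly_norm (f i - p)" for i
    using poly_norm_triangle[of "f i - p" p] poly_norm_triangle[of "p - f i" "f i"]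
      poly_norm_uminus[of "f i - p"] by simp
  then show "(\<lambda>i. poly_norm p - poly_norm (f i)) \<longlonglongrightarrow> 0"
    by (intro LIMSEQ_null_comparison[OF _ coeffs_tendsto_poly_norm_diff[OF assms]]) auto
qed

lemma coeffs_tendsto_if_poly_norm:
  assumes "(\<lambda>i. poly_norm (f i - p)) \<longlonglongrightarrow> 0"
  shows "coeffs_tendsto f p"
  unfolding coeffs_tendsto_def
proof
  fix j
  have "(\<lambda>i. coeff (f i) j - coeff p j) \<longlonglongrightarrow> 0"
    by (rule LIMSEQ_null_comparison[OF _ assms])
       (metis norm_coeff_le_poly_norm coeff_diff)
  then show "(\<lambda>i. coeff (f i) j) \<longlonglongrightarrow> coeff p j"
    by (simp add: LIM_zero_iff)
qed

lemma bounded_complex_sequence_subseq: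
  fixes s :: "nat \<Rightarrow> complex"
  assumes "\<And>i. cmod (s i) \<le> B"
  obtains \<sigma> l where "strict_mono \<sigma>" "(\<lambda>i. s (\<sigma> i)) \<longlonglongrightarrow> l"
proof -
  obtain f where f: "strict_mono f" "monoseq (\<lambda>i. Re (s (f i)))"
    using seq_monosub[of "\<lambda>i. Re (s i)"] by blast
  obtain g where g: "strict_mono g" "monoseq (\<lambda>i. Im (s (f (g i))))"
    using seq_monosub[of "\<lambda>i. Im (s (f i))"] by blast
  have "Bseq (\<lambda>i. Re (s (f i)))" "Bseq (\<lambda>i. Im (s (f (g i))))"
    by (rule BseqI'[of _ B], use assms abs_Re_le_cmod abs_Im_le_cmod in \<open>auto intro: order_trans\<close>)+
  then have "convergent (\<lambda>i. Re (s (f i)))" "convergent (\<lambda>i. Im (s (f (g i))))"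
    using f g by (auto intro: Bseq_monoseq_convergent)
  then obtain a b where "(\<lambda>i. Re (s (f i))) \<longlonglongrightarrow> a" and b: "(\<lambda>i. Im (s (f (g i)))) \<longlonglongrightarrow> b"
    by (auto simp: convergent_def)
  then have "(\<lambda>i. Re (s (f (g i)))) \<longlonglongrightarrow> a"
    using g LIMSEQ_subseq_LIMSEQ unfolding o_def by blast
  with b have "(\<lambda>i. Complex (Re (s (f (g i)))) (Im (s (f (g i))))) \<longlonglongrightarrow> Complex a b"
    by (intro tendsto_intros)
  then have "(\<lambda>i. s ((f \<circ> g) i)) \<longlonglongrightarrow> Complex a b"
    by simp
  with that[OF strict_mono_o[OF f(1) g(1)]] show ?thesis .
qed

lemma bounded_coefficients_subseq:
  fixes f :: "nat \<Rightarrow> cpoly"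
  assumes "\<And>i j. cmod (coeff (f i) j) \<le> B"
  shows "\<exists>\<sigma> l. strict_mono \<sigma> \<and> (\<forall>j<N. (\<lambda>i. coeff (f (\<sigma> i)) j) \<longlonglongrightarrow> l j)"
proof (induction N)
  case 0
  show ?case using strict_mono_id by blast
next
  case (Suc N)
  then obtain \<sigma> l where \<sigma>: "strict_mono \<sigma>" "\<And>j. j < N \<Longrightarrow> (\<lambda>i. coeff (f (\<sigma> i)) j) \<longlonglongrightarrow> l j"
    by blast
  obtain \<tau> a where \<tau>: "strict_mono \<tau>" "(\<lambda>i. coeff (f (\<sigma> (\<tau> i))) N) \<longlonglongrightarrow> a"
    using bounded_complex_sequence_subseq[of "\<lambda>i. coeff (f (\<sigma> i)) N" B] assms by blast
  have "(\<lambda>i. coeff (f ((\<sigma> \<circ> \<tau>) i)) j) \<longlonglongrightarrow> (l(N := a)) j" if "j < Suc N" for j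
    using that \<tau> LIMSEQ_subseq_LIMSEQ[OF \<sigma>(2)[of j] \<tau>(1)] by (cases "j = N") (auto simp: o_def)
  with strict_mono_o[OF \<sigma>(1) \<tau>(1)] show ?case by blast
qed

lemma bounded_polys_subseq:
  fixes f :: "nat \<Rightarrow> cpoly"
  assumes "\<And>i. degree (f i) \<le> N" "\<And>i. poly_norm (f i) \<le> B"
  obtains \<sigma> p where "strict_mono \<sigma>" "coeffs_tendsto (\<lambda>i. f (\<sigma> i)) p" "degree p \<le> N"
proof -
  have "cmod (coeff (f i) j) \<le> B" for i j
    using norm_coeff_le_poly_norm assms(2) by (rule order_trans)
  then obtain \<sigma> l where \<sigma>: "strict_mono \<sigma>"
    and l: "\<And>j. j < Suc N \<Longrightarrow> (\<lambda>i. coeff (f (\<sigma> i)) j) \<longlonglongrightarrow> l j"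
    using bounded_coefficients_subseq[of f B "Suc N"] by blast
  define p where "p = (\<Sum>j<Suc N. monom (l j) j)"
  have p: "coeff p j = (if j < Suc N then l j else 0)" for j
    by (auto simp: p_def coeff_sum if_distrib cong: if_cong)
  have "coeffs_tendsto (\<lambda>i. f (\<sigma> i)) p"
    unfolding coeffs_tendsto_def
  proof
    fix j
    show "(\<lambda>i. coeff (f (\<sigma> i)) j) \<longlonglongrightarrow> coeff p j"
    proof (cases "j < Suc N")
      case False
      with assms(1) have "coeff (f (\<sigma> i)) j = 0" for i
        by (meson coeff_eq_0 le_less_trans not_less_eq)
      with False p show ?thesis by simp
    qed (use l p in simp)
  qed
  then show ?thesis
    using that \<sigma> coeffs_tendsto_degree_le assms(1) by blast
qed

lemma bounded_poly_triples_subseq: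
  fixes u v w :: "nat \<Rightarrow> cpoly"
  assumes deg: "\<And>i. degree (u i) \<le> a" "\<And>i. degree (v i) \<le> b" "\<And>i. degree (w i) \<le> c"
    and nrm: "\<And>i. poly_norm (u i) \<le> A" "\<And>i. poly_norm (v i) \<le> B" "\<And>i. poly_norm (w i) \<le> C"
  obtains \<sigma> u' v' w' where "strict_mono \<sigma>" "coeffs_tendsto (\<lambda>i. u (\<sigma> i)) u'"
    "coeffs_tendsto (\<lambda>i. v (\<sigma> i)) v'" "coeffs_tendsto (\<lambda>i. w (\<sigma> i)) w'"
proof -
  obtain \<sigma>1 u' where s1: "strict_mono \<sigma>1" "coeffs_tendsto (\<lambda>i. u (\<sigma>1 i)) u'"
    using bounded_polys_subseq[of u, OF deg(1) nrm(1)] by blast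
  obtain \<sigma>2 v' where s2: "strict_mono \<sigma>2" "coeffs_tendsto (\<lambda>i. v (\<sigma>1 (\<sigma>2 i))) v'"
    using bounded_polys_subseq[of "\<lambda>i. v (\<sigma>1 i)", OF deg(2) nrm(2)] by blast
  obtain \<sigma>3 w' where s3: "strict_mono \<sigma>3" "coeffs_tendsto (\<lambda>i. w (\<sigma>1 (\<sigma>2 (\<sigma>3 i)))) w'"
    using bounded_polys_subseq[of "\<lambda>i. w (\<sigma>1 (\<sigma>2 i))", OF deg(3) nrm(3)] by blast
  show ?thesis
  proof (rule that[of "\<lambda>i. \<sigma>1 (\<sigma>2 (\<sigma>3 i))"])
    show "strict_mono (\<lambda>i. \<sigma>1 (\<sigma>2 (\<sigma>3 i)))"
      using strict_mono_o[OF s1(1) strict_mono_o[OF s2(1) s3(1)]] by (simp add: o_def)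
    show "coeffs_tendsto (\<lambda>i. u (\<sigma>1 (\<sigma>2 (\<sigma>3 i)))) u'"
      by (rule coeffs_tendsto_subseq[OF coeffs_tendsto_subseq[OF s1(2) s2(1)] s3(1)])
    show "coeffs_tendsto (\<lambda>i. v (\<sigma>1 (\<sigma>2 (\<sigma>3 i)))) v'"
      by (rule coeffs_tendsto_subseq[OF s2(2) s3(1)])
  qed (rule s3(2))
qed

lemma poly_norm_normalize:
  assumes "u \<noteq> 0"
  shows "poly_norm (smult (of_real (1 / poly_norm u)) u) = 1"
  using assms by (simp add: poly_norm_smult norm_divide)

text \<open>If the bound failed for every constant, normalized factors would have products tending to 0,
  and a limit point would be a pair of nonzero polynomials with product 0.  This bounds a cofactor
  once the divisor is normalized.\<close>

lemma poly_norm_mult_lower_bound: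
  obtains C where "C > 0"
    "\<And>u v. degree u \<le> a \<Longrightarrow> degree v \<le> b \<Longrightarrow> poly_norm u * poly_norm v \<le> C * poly_norm (u * v)"
proof -
  have "\<exists>C>0. \<forall>u v. degree u \<le> a \<longrightarrow> degree v \<le> b \<longrightarrow> poly_norm u * poly_norm v \<le> C * poly_norm (u * v)"
  proof (rule ccontr)
    assume neg: "\<not> ?thesis"
    have "\<exists>u v. degree u \<le> a \<and> degree v \<le> b \<and> poly_norm u = 1 \<and> poly_norm v = 1 \<and>
            poly_norm (u * v) \<le> 1 / real (Suc i)" for i
    proof -
      from neg obtain u v where uv: "degree u \<le> a" "degree v \<le> b"
        "\<not> poly_norm u * poly_norm v \<le> real (Suc i) * poly_norm (u * v)"
        using of_nat_0_less_iff zero_less_Suc by blast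
      then have nz: "u \<noteq> 0" "v \<noteq> 0" by auto
      let ?u = "smult (of_real (1 / poly_norm u)) u" and ?v = "smult (of_real (1 / poly_norm v)) v"
      have "?u * ?v = smult (of_real (1 / (poly_norm u * poly_norm v))) (u * v)"
        by (simp add: mult.commute)
      then have "poly_norm (?u * ?v) = poly_norm (u * v) / (poly_norm u * poly_norm v)"
        by (simp only: poly_norm_smult norm_of_real) (simp add: abs_mult)
      also have "\<dots> \<le> 1 / real (Suc i)"
      proof -
        have "0 < poly_norm u * poly_norm v"
          using nz by (intro mult_pos_pos) (auto simp: less_le)
        with uv(3) show ?thesis by (simp add: divide_simps) (simp add: algebra_simps)
      qed
      finally have "poly_norm (?u * ?v) \<le> 1 / real (Suc i)" .
      moreover have "degree ?u \<le> a" "degree ?v \<le> b"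
        using uv(1,2) degree_smult_le order_trans by blast+
      ultimately show ?thesis
        using poly_norm_normalize[OF nz(1)] poly_norm_normalize[OF nz(2)] by blast
    qed
    then obtain u v where deg: "\<And>i. degree (u i) \<le> a" "\<And>i. degree (v i) \<le> b"
      and nrm: "\<And>i. poly_norm (u i) = 1" "\<And>i. poly_norm (v i) = 1"
      and small: "\<And>i. poly_norm (u i * v i) \<le> 1 / real (Suc i)"
      by metis
    obtain \<sigma> u' where \<sigma>: "strict_mono \<sigma>" "coeffs_tendsto (\<lambda>i. u (\<sigma> i)) u'"
      using bounded_polys_subseq[of u a 1] deg(1) nrm(1) by (metis order_refl)
    obtain \<tau> v' where \<tau>: "strict_mono \<tau>" "coeffs_tendsto (\<lambda>i. v (\<sigma> (\<tau> i))) v'"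
      using bounded_polys_subseq[of "\<lambda>i. v (\<sigma> i)" b 1] deg(2) nrm(2) by (metis order_refl)
    have u': "coeffs_tendsto (\<lambda>i. u (\<sigma> (\<tau> i))) u'"
      using coeffs_tendsto_subseq[OF \<sigma>(2) \<tau>(1)] .
    have "poly_norm u' = 1" "poly_norm v' = 1"
      using coeffs_tendsto_poly_norm[OF u' deg(1)] coeffs_tendsto_poly_norm[OF \<tau>(2) deg(2)]
      by (auto simp: nrm LIMSEQ_const_iff)
    then have "u' * v' \<noteq> 0" by auto
    moreover have "coeffs_tendsto (\<lambda>i. u (\<sigma> (\<tau> i)) * v (\<sigma> (\<tau> i))) 0"
    proof (rule coeffs_tendsto_subseq[OF coeffs_tendsto_subseq[OF _ \<sigma>(1)] \<tau>(1)],
        rule coeffs_tendsto_if_poly_norm)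
      show "(\<lambda>i. poly_norm (u i * v i - 0)) \<longlonglongrightarrow> 0"
        by (rule LIMSEQ_null_comparison[OF _ LIMSEQ_one_over_Suc]) (use small in simp)
    qed
    ultimately show False
      using coeffs_tendsto_unique coeffs_tendsto_mult[OF u' \<tau>(2)] by blast
  qed
  with that show ?thesis by blast
qed

text \<open>Degrees can only drop in a limit, but the degrees of the limit factors must add up to \<open>m\<close>.
  Hence the limit of common divisors of degree \<open>j\<close> again has degree exactly \<open>j\<close>.\<close>

lemma factorizations_subseq:
  assumes pq: "(p, q) \<in> pairs_exact m n" and j: "j \<le> m" "j \<le> n"
    and deg: "\<And>i. degree (u i) \<le> j" "\<And>i. degree (v i) \<le> m - j" "\<And>i. degree (w i) \<le> n - j"
    and nrm: "\<And>i. poly_norm (u i) = 1"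
    and lim: "(\<lambda>i. pair_norm ((u i * v i, u i * w i) - (p, q))) \<longlonglongrightarrow> 0"
  obtains \<sigma> u' v' w' where "strict_mono \<sigma>" "coeffs_tendsto (\<lambda>i. u (\<sigma> i)) u'"
    "coeffs_tendsto (\<lambda>i. v (\<sigma> i)) v'" "coeffs_tendsto (\<lambda>i. w (\<sigma> i)) w'"
    "u' * v' = p" "u' * w' = q" "degree u' = j"
proof -
  have "norm (poly_norm (u i * v i - p)) \<le> pair_norm ((u i * v i, u i * w i) - (p, q))"
       "norm (poly_norm (u i * w i - q)) \<le> pair_norm ((u i * v i, u i * w i) - (p, q))" for i
    using poly_norm_fst_le[of "(u i * v i, u i * w i) - (p, q)"]
      poly_norm_snd_le[of "(u i * v i, u i * w i) - (p, q)"] by simp_all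
  then have p0: "(\<lambda>i. poly_norm (u i * v i - p)) \<longlonglongrightarrow> 0"
    and q0: "(\<lambda>i. poly_norm (u i * w i - q)) \<longlonglongrightarrow> 0"
    by - (rule LIMSEQ_null_comparison[OF _ lim], assumption)+
  obtain B1 where B1: "\<And>i. poly_norm (u i * v i - p) \<le> B1"
    using convergent_imp_Bseq[OF convergentI[OF p0]] by (auto simp: Bseq_def)
  obtain B2 where B2: "\<And>i. poly_norm (u i * w i - q) \<le> B2"
    using convergent_imp_Bseq[OF convergentI[OF q0]] by (auto simp: Bseq_def)
  obtain C1 where "C1 > 0" and *: "\<And>f g. degree f \<le> j \<Longrightarrow> degree g \<le> m - j \<Longrightarrow>
      poly_norm f * poly_norm g \<le> C1 * poly_norm (f * g)"
    using poly_norm_mult_lower_bound[of j "m - j"] by blast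
  then have C1: "C1 > 0" "poly_norm (v i) \<le> C1 * poly_norm (u i * v i)" for i
    using *[OF deg(1) deg(2), of i i] nrm[of i] by auto
  obtain C2 where "C2 > 0" and *: "\<And>f g. degree f \<le> j \<Longrightarrow> degree g \<le> n - j \<Longrightarrow>
      poly_norm f * poly_norm g \<le> C2 * poly_norm (f * g)"
    using poly_norm_mult_lower_bound[of j "n - j"] by blast
  then have C2: "C2 > 0" "poly_norm (w i) \<le> C2 * poly_norm (u i * w i)" for i
    using *[OF deg(1) deg(3), of i i] nrm[of i] by auto
  have v: "poly_norm (v i) \<le> C1 * (B1 + poly_norm p)" for i
    using poly_norm_triangle[of "u i * v i - p" p] B1[of i] C1(1)
    by (intro order_trans[OF C1(2)] mult_left_mono) auto
  have w: "poly_norm (w i) \<le> C2 * (B2 + poly_norm q)" for i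
    using poly_norm_triangle[of "u i * w i - q" q] B2[of i] C2(1)
    by (intro order_trans[OF C2(2)] mult_left_mono) auto
  obtain \<sigma> u' v' w' where \<sigma>: "strict_mono \<sigma>" and lims: "coeffs_tendsto (\<lambda>i. u (\<sigma> i)) u'"
    "coeffs_tendsto (\<lambda>i. v (\<sigma> i)) v'" "coeffs_tendsto (\<lambda>i. w (\<sigma> i)) w'"
    by (rule bounded_poly_triples_subseq[OF deg eq_refl[OF nrm] v w])
  have prod: "u' * v' = p" "u' * w' = q"
    using coeffs_tendsto_unique[OF coeffs_tendsto_mult[OF lims(1,2)]]
      coeffs_tendsto_unique[OF coeffs_tendsto_mult[OF lims(1,3)]]
      coeffs_tendsto_subseq[OF coeffs_tendsto_if_poly_norm[OF p0] \<sigma>]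
      coeffs_tendsto_subseq[OF coeffs_tendsto_if_poly_norm[OF q0] \<sigma>] by auto
  have "degree u' \<le> j" "degree v' \<le> m - j"
    by (rule coeffs_tendsto_degree_le[OF lims(1) deg(1)], rule coeffs_tendsto_degree_le[OF lims(2) deg(2)])
  then have "degree u' = j"
    using prod pq j by (auto simp: pairs_exact_def degree_mult_eq)
  with that \<sigma> lims prod show ?thesis by blast
qed

section \<open>Degrees under small perturbations\<close>

text \<open>A perturbation smaller than the leading coefficients cannot annihilate them.\<close>

lemma pairs_exact_open:
  assumes "pq0 \<in> pairs_exact m n"
  obtains r where "r > 0"
    "\<And>pq. pq \<in> pairs_upto m n \<Longrightarrow> pair_norm (pq - pq0) < r \<Longrightarrow> pq \<in> pairs_exact m n"
proof -
  obtain p0 q0 where pq0: "pq0 = (p0, q0)" by (cases pq0)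
  with assms have nz: "coeff p0 m \<noteq> 0" "coeff q0 n \<noteq> 0"
    by (auto simp: pairs_exact_def)
  let ?r = "min (cmod (coeff p0 m)) (cmod (coeff q0 n))"
  have key: "f \<noteq> 0 \<and> degree f = d"
    if "degree f \<le> d" "poly_norm (f - f0) < cmod (coeff f0 d)" for f f0 d
  proof -
    have "cmod (coeff f d - coeff f0 d) < cmod (coeff f0 d)"
      using norm_coeff_le_poly_norm[of "f - f0" d] that(2) by simp
    then have "coeff f d \<noteq> 0" by (auto simp: norm_minus_commute)
    then show ?thesis using that(1) by (auto intro: antisym le_degree)
  qed
  show ?thesis
  proof (rule that[of ?r])
    show "0 < ?r" using nz by simp
    fix pq assume *: "pq \<in> pairs_upto m n" "pair_norm (pq - pq0) < ?r"
    obtain p q where pq: "pq = (p, q)" by (cases pq)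
    have "poly_norm (p - p0) < cmod (coeff p0 m)" "poly_norm (q - q0) < cmod (coeff q0 n)"
      using *(2) poly_norm_fst_le[of "pq - pq0"] poly_norm_snd_le[of "pq - pq0"] by (auto simp: pq pq0)
    with *(1) show "pq \<in> pairs_exact m n"
      using key by (auto simp: pq pairs_upto_def pairs_exact_def)
  qed
qed

lemma gcd_factorization_normalized:
  assumes "rs \<in> pairs_gcd_degree m n j"
  obtains u v w where "(u, v, w) \<in> gcd_triples rs" "poly_norm u = 1"
proof -
  obtain r s where rs: "rs = (r, s)" by (cases rs)
  let ?g = "gcd r s"
  have nz: "r \<noteq> 0" using assms by (auto simp: rs pairs_gcd_degree_iff)
  then have g: "?g \<noteq> 0" by simp
  have "smult (of_real (1 / poly_norm ?g)) ?g \<in> gcds rs"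
    using nz g unfolding rs gcds_eq_sim_class[OF nz] poly_sim_def by (auto intro!: exI[of _ "of_real (1 / poly_norm ?g)"])
  then obtain v w where "(smult (of_real (1 / poly_norm ?g)) ?g, v, w) \<in> gcd_triples rs"
    using gcd_triples_exist[OF assms] by blast
  with that poly_norm_normalize[OF g] show ?thesis by blast
qed

text \<open>Pairs with a GCD of degree \<open>j\<close> that approach \<open>pq0\<close> would, by compactness, leave a common divisor
  of degree \<open>j\<close> in the limit.\<close>

lemma gcd_degree_upper_semicontinuous:
  assumes "pq0 \<in> pairs_gcd_degree m n k"
  obtains r where "r > 0"
    "\<And>j rs. k < j \<Longrightarrow> rs \<in> pairs_gcd_degree m n j \<Longrightarrow> r \<le> pair_norm (rs - pq0)"
proof -
  obtain p0 q0 where pq0: "pq0 = (p0, q0)" by (cases pq0)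
  have exact: "(p0, q0) \<in> pairs_exact m n"
    using assms by (simp add: pq0 pairs_gcd_degree_def)
  have "\<exists>r>0. \<forall>rs\<in>pairs_gcd_degree m n j. r \<le> pair_norm (rs - pq0)" if j: "k < j" "j \<le> m" "j \<le> n" for j
  proof (rule ccontr)
    assume neg: "\<not> ?thesis"
    have "\<exists>u v w. degree u \<le> j \<and> degree v \<le> m - j \<and> degree w \<le> n - j \<and> poly_norm u = 1 \<and>
        pair_norm ((u * v, u * w) - pq0) \<le> 1 / real (Suc i)" for i
    proof -
      have "0 < 1 / real (Suc i)" by simp
      with neg obtain rs where rs: "rs \<in> pairs_gcd_degree m n j" "pair_norm (rs - pq0) < 1 / real (Suc i)"
        by (meson not_le)
      then obtain u v w where uvw: "(u, v, w) \<in> gcd_triples rs" "poly_norm u = 1"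
        using gcd_factorization_normalized by blast
      then have "rs = (u * v, u * w)" by (simp add: gcd_triples_def)
      then show ?thesis
        using rs(2) gcd_triples_degrees[OF rs(1) uvw(1)] uvw(2)
        by (intro exI[of _ u] exI[of _ v] exI[of _ w]) simp
    qed
    then obtain u v w where deg: "\<And>i. degree (u i) \<le> j" "\<And>i. degree (v i) \<le> m - j" "\<And>i. degree (w i) \<le> n - j"
      and nrm: "\<And>i. poly_norm (u i) = 1"
      and small: "\<And>i. pair_norm ((u i * v i, u i * w i) - pq0) \<le> 1 / real (Suc i)"
      by metis
    have lim: "(\<lambda>i. pair_norm ((u i * v i, u i * w i) - (p0, q0))) \<longlonglongrightarrow> 0"
      unfolding pq0[symmetric]
      by (rule LIMSEQ_null_comparison[OF _ LIMSEQ_one_over_Suc]) (use small in simp)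
    obtain u' v' w' where "u' * v' = p0" "u' * w' = q0" "degree u' = j"
      by (rule factorizations_subseq[OF exact j(2,3) deg nrm lim])
    then have "u' dvd gcd p0 q0" by (metis dvd_triv_left gcd_greatest)
    with \<open>degree u' = j\<close> assms have "j \<le> k"
      using dvd_imp_degree_le[of u' "gcd p0 q0"] by (simp add: pq0 pairs_gcd_degree_iff)
    with j show False by simp
  qed
  then have "\<forall>j\<in>{k<..min m n}. \<exists>r>0. \<forall>rs\<in>pairs_gcd_degree m n j. r \<le> pair_norm (rs - pq0)"
    by simp
  then obtain r where r: "\<forall>j\<in>{k<..min m n}. r j > 0 \<and> (\<forall>rs\<in>pairs_gcd_degree m n j. r j \<le> pair_norm (rs - pq0))"
    by (auto dest: bchoice)
  define R where "R = Min (insert 1 (r ` {k<..min m n}))"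
  show ?thesis
  proof (rule that[of R])
    show "0 < R" unfolding R_def using r by (subst Min_gr_iff) auto
    fix j rs assume *: "k < j" "rs \<in> pairs_gcd_degree m n j"
    with pairs_gcd_degree_bound have "j \<le> min m n" by auto
    with * have j: "j \<in> {k<..min m n}" by simp
    then have "R \<le> r j"
      unfolding R_def by (intro Min_le) auto
    also have "r j \<le> pair_norm (rs - pq0)"
      using r j * by blast
    finally show "R \<le> pair_norm (rs - pq0)" .
  qed
qed

section \<open>The factorization map and its linearization\<close>

definition triples_upto :: "nat \<Rightarrow> nat \<Rightarrow> nat \<Rightarrow> (cpoly \<times> cpoly \<times> cpoly) set" where
  "triples_upto m n k = {(u, v, w). degree u \<le> k \<and> degree v \<le> m - k \<and> degree w \<le> n - k}"

definition expand :: "cpoly \<times> cpoly \<times> cpoly \<Rightarrow> cpoly \<times> cpoly" where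
  "expand = (\<lambda>(u, v, w). (u * v, u * w))"

text \<open>The derivative of \<^const>\<open>expand\<close> at the first argument in the direction of the second.\<close>

definition expand_deriv :: "cpoly \<times> cpoly \<times> cpoly \<Rightarrow> cpoly \<times> cpoly \<times> cpoly \<Rightarrow> cpoly \<times> cpoly" where
  "expand_deriv = (\<lambda>(u, v, w) (x, y, z). (u * y + v * x, u * z + w * x))"

text \<open>The functional \<open>u \<mapsto> h\<^sup>H u\<close> given by the first row of \<^const>\<open>J_mat\<close>.  Prescribing its value
  singles out one representative of a class of GCDs.\<close>

definition row_functional :: "complex vec \<Rightarrow> cpoly \<Rightarrow> complex" where
  "row_functional h u = (\<Sum>i<dim_vec h. cnj (h $ i) * coeff u i)"

section \<open>Induced norm and pseudoinverse\<close>

lemma euclid_norm_eq_L2_set: "euclid_norm x = L2_set (\<lambda>i. cmod (x $ i)) {..<dim_vec x}"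
  by (simp add: euclid_norm_def L2_set_def)

lemma euclid_norm_nonneg [simp]: "0 \<le> euclid_norm x"
  by (simp add: euclid_norm_eq_L2_set)

lemma euclid_norm_smult: "euclid_norm (c \<cdot>\<^sub>v x) = cmod c * euclid_norm x"
  unfolding euclid_norm_eq_L2_set
  by (subst L2_set_right_distrib) (auto simp: norm_mult intro!: L2_set_cong)

lemma euclid_norm_eq_0_iff:
  assumes "x \<in> carrier_vec n"
  shows "euclid_norm x = 0 \<longleftrightarrow> x = 0\<^sub>v n"
  using assms by (auto simp: euclid_norm_eq_L2_set L2_set_eq_0_iff)

lemma euclid_norm_append_vec:
  "euclid_norm (x @\<^sub>v y) = sqrt ((euclid_norm x)\<^sup>2 + (euclid_norm y)\<^sup>2)"
proof -
  have "(\<Sum>i<dim_vec x + dim_vec y. (cmod ((x @\<^sub>v y) $ i))\<^sup>2) =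
      (\<Sum>i<dim_vec x. (cmod (x $ i))\<^sup>2) + (\<Sum>i<dim_vec y. (cmod (y $ i))\<^sup>2)"
    using sum.atLeastLessThan_concat[of 0 "dim_vec x" "dim_vec x + dim_vec y" "\<lambda>i. (cmod ((x @\<^sub>v y) $ i))\<^sup>2"]
      sum.shift_bounds_nat_ivl[of "\<lambda>i. (cmod ((x @\<^sub>v y) $ i))\<^sup>2" 0 "dim_vec x" "dim_vec y"]
    by (simp add: atLeast0LessThan add.commute)
  then show ?thesis
    by (simp add: euclid_norm_def sum_nonneg)
qed

text \<open>The supremum in \<^const>\<open>mat_norm\<close> is only meaningful once it is known to be bounded, which the sum
  of the moduli of all entries shows.\<close>

lemma euclid_norm_mult_mat_vec_le:
  assumes A: "A \<in> carrier_mat r c" and x: "x \<in> carrier_vec c"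
  shows "euclid_norm (A *\<^sub>v x) \<le> mat_norm A * euclid_norm x"
proof (cases "x = 0\<^sub>v c")
  case True
  then have "A *\<^sub>v x = 0\<^sub>v r" using A by auto
  with True show ?thesis
    by (simp add: euclid_norm_eq_0_iff[THEN iffD2, of _ r] euclid_norm_eq_0_iff[THEN iffD2, of _ c])
next
  case False
  then have pos: "euclid_norm x > 0"
    using euclid_norm_eq_0_iff[OF x] by (simp add: less_le)
  let ?S = "{x \<in> carrier_vec (dim_col A). euclid_norm x = 1}"
  define y where "y = complex_of_real (1 / euclid_norm x) \<cdot>\<^sub>v x"
  have y: "y \<in> ?S"
    using A x pos by (simp add: y_def euclid_norm_smult norm_divide)
  have "bdd_above ((\<lambda>x. euclid_norm (A *\<^sub>v x)) ` ?S)"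
  proof (rule bdd_aboveI2)
    fix z assume z: "z \<in> ?S"
    have le1: "cmod (z $ j) \<le> 1" if "j < c" for j
      using member_le_L2_set[of "{..<c}" j "\<lambda>j. cmod (z $ j)"] z A that
      by (auto simp: euclid_norm_eq_L2_set)
    have "euclid_norm (A *\<^sub>v z) \<le> (\<Sum>i<r. cmod ((A *\<^sub>v z) $ i))"
      using A unfolding euclid_norm_eq_L2_set by (intro L2_set_le_sum[THEN order_trans]) auto
    also have "\<dots> \<le> (\<Sum>i<r. \<Sum>j<c. cmod (A $$ (i, j)))"
    proof (intro sum_mono)
      fix i assume "i \<in> {..<r}"
      then have "(A *\<^sub>v z) $ i = (\<Sum>j<c. A $$ (i, j) * z $ j)"
        using A z by (auto simp: scalar_prod_def atLeast0LessThan)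
      also have "cmod \<dots> \<le> (\<Sum>j<c. cmod (A $$ (i, j) * z $ j))"
        by (rule norm_sum)
      also have "\<dots> \<le> (\<Sum>j<c. cmod (A $$ (i, j)))"
        by (intro sum_mono) (simp add: norm_mult mult_left_le le1)
      finally show "cmod ((A *\<^sub>v z) $ i) \<le> (\<Sum>j<c. cmod (A $$ (i, j)))" .
    qed
    finally show "euclid_norm (A *\<^sub>v z) \<le> (\<Sum>i<r. \<Sum>j<c. cmod (A $$ (i, j)))" .
  qed
  then have "euclid_norm (A *\<^sub>v y) \<le> mat_norm A"
    unfolding mat_norm_def using y by (rule cSUP_upper[rotated])
  moreover have "euclid_norm (A *\<^sub>v y) = euclid_norm (A *\<^sub>v x) / euclid_norm x"
    using pos mult_mat_vec[OF A x] by (simp add: y_def euclid_norm_smult norm_divide)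
  ultimately show ?thesis
    using pos by (simp add: divide_simps)
qed

lemma mat_injective_iff_kernel:
  assumes A: "A \<in> carrier_mat r c"
  shows "mat_injective A \<longleftrightarrow> (\<forall>x\<in>carrier_vec c. A *\<^sub>v x = 0\<^sub>v r \<longrightarrow> x = 0\<^sub>v c)"
proof
  assume "mat_injective A"
  then show "\<forall>x\<in>carrier_vec c. A *\<^sub>v x = 0\<^sub>v r \<longrightarrow> x = 0\<^sub>v c"
  proof (intro ballI impI)
    fix x assume x: "x \<in> carrier_vec c" "A *\<^sub>v x = 0\<^sub>v r"
    have "A *\<^sub>v 0\<^sub>v c = 0\<^sub>v r" using A by auto
    have "inj_on (\<lambda>x. A *\<^sub>v x) (carrier_vec c)"
      using A \<open>mat_injective A\<close> by (simp add: mat_injective_def)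
    then show "x = 0\<^sub>v c"
      by (rule inj_onD) (simp_all add: x \<open>A *\<^sub>v 0\<^sub>v c = 0\<^sub>v r\<close>)
  qed
next
  assume *: "\<forall>x\<in>carrier_vec c. A *\<^sub>v x = 0\<^sub>v r \<longrightarrow> x = 0\<^sub>v c"
  show "mat_injective A"
    unfolding mat_injective_def
  proof (rule inj_onI)
    fix x y assume xy: "x \<in> carrier_vec (dim_col A)" "y \<in> carrier_vec (dim_col A)"
      and eq: "A *\<^sub>v x = A *\<^sub>v y"
    with A have xy': "x \<in> carrier_vec c" "y \<in> carrier_vec c" by auto
    have "A *\<^sub>v (x - y) = 0\<^sub>v r"
      unfolding mult_minus_distrib_mat_vec[OF A xy'] eq using A by (intro eq_vecI) auto
    with * xy' have "x - y = 0\<^sub>v c" by simp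
    then have "(x - y) $ i = 0" if "i < c" for i
      using that by simp
    then show "x = y"
      using xy' by (intro eq_vecI) auto
  qed
qed

lemma mat_adjoint_carrier:
  fixes A :: "complex mat"
  shows "A \<in> carrier_mat r c \<Longrightarrow> mat_adjoint A \<in> carrier_mat c r"
  by (auto simp: mat_adjoint_def)

lemma mat_adjoint_index:
  fixes A :: "complex mat"
  shows "A \<in> carrier_mat r c \<Longrightarrow> i < c \<Longrightarrow> j < r \<Longrightarrow> mat_adjoint A $$ (i, j) = cnj (A $$ (j, i))"
  by (auto simp: mat_adjoint_def mat_of_rows_index)

text \<open>The squared norm of \<open>A v\<close> is \<open>v\<^sup>H (A\<^sup>H A v)\<close>.\<close>

lemma gram_kernel:
  fixes A :: "complex mat"
  assumes A: "A \<in> carrier_mat r c" and v: "v \<in> carrier_vec c"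
    and zero: "(mat_adjoint A * A) *\<^sub>v v = 0\<^sub>v c"
  shows "A *\<^sub>v v = 0\<^sub>v r"
proof -
  define w where "w = A *\<^sub>v v"
  have w: "w \<in> carrier_vec r" using A v by (simp add: w_def)
  have wj: "w $ j = (\<Sum>i<c. A $$ (j, i) * v $ i)" if "j < r" for j
    using A v that by (auto simp: w_def scalar_prod_def atLeast0LessThan)
  have "mat_adjoint A *\<^sub>v w = 0\<^sub>v c"
    using zero assoc_mult_mat_vec[OF mat_adjoint_carrier[OF A] A v] by (simp add: w_def)
  then have col: "(\<Sum>j<r. cnj (A $$ (j, i)) * w $ j) = 0" if "i < c" for i
  proof -
    have "(\<Sum>j<r. cnj (A $$ (j, i)) * w $ j) = (mat_adjoint A *\<^sub>v w) $ i"
      using mat_adjoint_carrier[OF A] w that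
      by (auto simp: scalar_prod_def atLeast0LessThan mat_adjoint_index[OF A])
    with \<open>mat_adjoint A *\<^sub>v w = 0\<^sub>v c\<close> that show ?thesis by simp
  qed
  have "of_real (\<Sum>j<r. (cmod (w $ j))\<^sup>2) = (\<Sum>j<r. cnj (w $ j) * w $ j)"
    by (simp add: complex_norm_square mult.commute flip: of_real_power)
  also have "\<dots> = (\<Sum>j<r. \<Sum>i<c. cnj (v $ i) * (cnj (A $$ (j, i)) * w $ j))"
    by (intro sum.cong refl) (simp add: wj sum_distrib_left sum_distrib_right mult_ac)
  also have "\<dots> = (\<Sum>i<c. cnj (v $ i) * (\<Sum>j<r. cnj (A $$ (j, i)) * w $ j))"
    by (subst sum.swap) (simp add: sum_distrib_left)
  also have "\<dots> = 0" by (simp add: col)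
  finally have "(\<Sum>j<r. (cmod (w $ j))\<^sup>2) = 0"
    using of_real_eq_0_iff by blast
  then have "w $ j = 0" if "j < r" for j
    using that by (simp add: sum_nonneg_eq_0_iff)
  with w show ?thesis unfolding w_def[symmetric] by auto
qed

lemma pseudo_inverse_left_inverse:
  assumes A: "A \<in> carrier_mat r c" and inj: "mat_injective A"
  shows "pseudo_inverse A \<in> carrier_mat c r" "pseudo_inverse A * A = 1\<^sub>m c"
proof -
  let ?M = "mat_adjoint A * A"
  have H: "mat_adjoint A \<in> carrier_mat c r" and M: "?M \<in> carrier_mat c c"
    using A mat_adjoint_carrier[OF A] by auto
  have "det ?M \<noteq> 0"
    unfolding det_0_iff_vec_prod_zero[OF M]
    using gram_kernel[OF A] inj mat_injective_iff_kernel[OF A] by blast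
  then have "?M \<in> Units (ring_mat TYPE(complex) c ())"
    by (rule det_non_zero_imp_unit[OF M])
  then obtain B where B: "mat_inverse ?M = Some B"
    using mat_inverse(1)[OF M, where b = "()"] by (cases "mat_inverse ?M") auto
  note B' = mat_inverse(2)[OF M B]
  have P: "pseudo_inverse A = B * mat_adjoint A"
    by (simp add: pseudo_inverse_def B)
  show "pseudo_inverse A \<in> carrier_mat c r"
    unfolding P using B' H by auto
  show "pseudo_inverse A * A = 1\<^sub>m c"
    unfolding P using assoc_mult_mat[of B c c "mat_adjoint A" r A c] B' H A by simp
qed

lemma euclid_norm_le_pseudo_inverse:
  assumes A: "A \<in> carrier_mat r c" and inj: "mat_injective A" and x: "x \<in> carrier_vec c"
  shows "euclid_norm x \<le> mat_norm (pseudo_inverse A) * euclid_norm (A *\<^sub>v x)"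
proof -
  note P = pseudo_inverse_left_inverse[OF A inj]
  have "pseudo_inverse A *\<^sub>v (A *\<^sub>v x) = x"
    using assoc_mult_mat_vec[OF P(1) A x] P(2) x by simp
  then show ?thesis
    using euclid_norm_mult_mat_vec_le[OF P(1), of "A *\<^sub>v x"] A x by simp
qed

lemma zero_mat_mult_vec:
  fixes x :: "complex vec"
  shows "x \<in> carrier_vec c \<Longrightarrow> 0\<^sub>m r c *\<^sub>v x = 0\<^sub>v r"
  by (intro eq_vecI) (auto simp: scalar_prod_def)

section \<open>The matrix of the linearized factorization\<close>

definition coeff_vec :: "nat \<Rightarrow> cpoly \<Rightarrow> complex vec" where
  "coeff_vec N p = vec (N + 1) (coeff p)"

lemma coeff_vec_carrier [simp]: "coeff_vec N p \<in> carrier_vec (N + 1)"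
  by (simp add: coeff_vec_def)

lemma coeff_vec_dim [simp]: "dim_vec (coeff_vec N p) = N + 1"
  by (simp add: coeff_vec_def)

lemma euclid_norm_coeff_vec: "degree p \<le> N \<Longrightarrow> euclid_norm (coeff_vec N p) = poly_norm p"
  by (simp add: poly_norm_eq_L2_set[of p N] euclid_norm_eq_L2_set coeff_vec_def lessThan_Suc_atMost
      cong: L2_set_cong_simp)

lemma coeff_vec_add: "coeff_vec N p + coeff_vec N q = coeff_vec N (p + q)"
  by (auto simp: coeff_vec_def)

lemma coeff_vec_surj:
  assumes "x \<in> carrier_vec (N + 1)"
  obtains p where "degree p \<le> N" "x = coeff_vec N p"
proof
  let ?p = "\<Sum>i\<le>N. monom (x $ i) i"
  show "degree ?p \<le> N"
    by (intro degree_sum_le) (auto intro: order_trans[OF degree_monom_le])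
  show "x = coeff_vec N ?p"
    using assms by (intro eq_vecI) (auto simp: coeff_vec_def coeff_sum)
qed

lemma conv_mat_mult:
  assumes "degree g \<le> j"
  shows "conv_mat l j f *\<^sub>v coeff_vec j g = coeff_vec (l + j) (f * g)"
proof (rule eq_vecI)
  fix r assume "r < dim_vec (coeff_vec (l + j) (f * g))"
  then have r: "r < l + j + 1" by simp
  have "f * g = f * (\<Sum>c\<le>j. monom (coeff g c) c)"
    using assms by (simp add: poly_as_sum_of_monoms')
  also have "\<dots> = (\<Sum>c<j+1. smult (coeff g c) (f * monom 1 c))"
    by (simp add: sum_distrib_left smult_monom lessThan_Suc_atMost flip: mult_smult_right)
  finally have "coeff (f * g) r = (\<Sum>c<j+1. coeff g c * coeff (f * monom 1 c) r)"
    by (simp only: coeff_sum coeff_smult)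
  with r show "(conv_mat l j f *\<^sub>v coeff_vec j g) $ r = coeff_vec (l + j) (f * g) $ r"
    by (simp add: conv_mat_def coeff_vec_def scalar_prod_def atLeast0LessThan mult.commute
        del: sum.lessThan_Suc)
qed (simp add: conv_mat_def)

definition triple_vec :: "nat \<Rightarrow> nat \<Rightarrow> nat \<Rightarrow> cpoly \<times> cpoly \<times> cpoly \<Rightarrow> complex vec" where
  "triple_vec m n k = (\<lambda>(u, v, w). coeff_vec k u @\<^sub>v (coeff_vec (m - k) v @\<^sub>v coeff_vec (n - k) w))"

lemma triple_vec_carrier:
  "triple_vec m n k x \<in> carrier_vec ((k + 1) + ((m - k + 1) + (n - k + 1)))"
  by (cases x) (rule carrier_vecI, simp add: triple_vec_def)

lemma euclid_norm_triple_vec: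
  "x \<in> triples_upto m n k \<Longrightarrow> euclid_norm (triple_vec m n k x) = triple_norm x"
  by (cases x) (auto simp: triples_upto_def triple_vec_def euclid_norm_append_vec
      euclid_norm_coeff_vec triple_norm_eq pair_norm_Pair)

lemma triple_vec_surj:
  assumes "x \<in> carrier_vec ((k + 1) + ((m - k + 1) + (n - k + 1)))"
  obtains z where "z \<in> triples_upto m n k" "x = triple_vec m n k z"
proof -
  let ?y = "vec_last x ((m - k + 1) + (n - k + 1))"
  have x: "x = vec_first x (k + 1) @\<^sub>v ?y"
    using vec_first_last_append[of x "k + 1" "(m - k + 1) + (n - k + 1)"] assms by simp
  have y: "?y = vec_first ?y (m - k + 1) @\<^sub>v vec_last ?y (n - k + 1)"
    using vec_first_last_append[of ?y "m - k + 1" "n - k + 1"] by simp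
  obtain u where u: "degree u \<le> k" "vec_first x (k + 1) = coeff_vec k u"
    using coeff_vec_surj[of "vec_first x (k + 1)" k] by auto
  obtain v where v: "degree v \<le> m - k" "vec_first ?y (m - k + 1) = coeff_vec (m - k) v"
    using coeff_vec_surj[of "vec_first ?y (m - k + 1)" "m - k"] by auto
  obtain w where w: "degree w \<le> n - k" "vec_last ?y (n - k + 1) = coeff_vec (n - k) w"
    using coeff_vec_surj[of "vec_last ?y (n - k + 1)" "n - k"] by auto
  have y': "?y = coeff_vec (m - k) v @\<^sub>v coeff_vec (n - k) w"
    using y unfolding v(2) w(2) .
  show ?thesis
  proof (rule that[of "(u, v, w)"])
    show "x = triple_vec m n k (u, v, w)"
      using x unfolding u(2) y' by (simp add: triple_vec_def)
  qed (use u v w in \<open>simp add: triples_upto_def\<close>)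
qed

lemma J_mat_carrier:
  assumes "k \<le> m" "k \<le> n" "h \<in> carrier_vec (k + 1)"
  shows "J_mat m n k h u v w \<in>
     carrier_mat (1 + ((m + 1) + (n + 1))) ((k + 1) + ((m - k + 1) + (n - k + 1)))"
  using assms unfolding J_mat_def
  by (auto intro!: four_block_carrier_mat simp: conv_mat_def append_rows_def)

lemma J_mat_mult_triple_vec:
  assumes kmn: "k \<le> m" "k \<le> n" and h: "h \<in> carrier_vec (k + 1)" and x: "x \<in> triples_upto m n k"
  shows "J_mat m n k h u v w *\<^sub>v triple_vec m n k x =
     vec 1 (\<lambda>_. row_functional h (fst x)) @\<^sub>v
     (coeff_vec m (fst (expand_deriv (u, v, w) x)) @\<^sub>v coeff_vec n (snd (expand_deriv (u, v, w) x)))"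
proof -
  obtain a b c where xabc: "x = (a, b, c)" by (cases x)
  with x have deg: "degree a \<le> k" "degree b \<le> m - k" "degree c \<le> n - k"
    by (auto simp: triples_upto_def)
  have C: "conv_mat (m - k) k v \<in> carrier_mat (m + 1) (k + 1)" "conv_mat (n - k) k w \<in> carrier_mat (n + 1) (k + 1)"
    "conv_mat k (m - k) u \<in> carrier_mat (m + 1) (m - k + 1)" "conv_mat k (n - k) u \<in> carrier_mat (n + 1) (n - k + 1)"
    using kmn by (simp_all add: conv_mat_def)
  have tail: "coeff_vec (m - k) b @\<^sub>v coeff_vec (n - k) c \<in> carrier_vec ((m - k + 1) + (n - k + 1))"
    by (rule carrier_vecI) simp
  have top: "mat_of_row (conjugate h) *\<^sub>v coeff_vec k a = vec 1 (\<lambda>_. row_functional h a)"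
    using h by (intro eq_vecI) (auto simp: row_functional_def coeff_vec_def scalar_prod_def atLeast0LessThan)
  have mid: "(conv_mat (m - k) k v @\<^sub>r conv_mat (n - k) k w) *\<^sub>v coeff_vec k a =
      coeff_vec m (v * a) @\<^sub>v coeff_vec n (w * a)"
    using mat_mult_append[OF C(1,2) coeff_vec_carrier] conv_mat_mult[OF deg(1)] kmn by simp
  have bot: "four_block_mat (conv_mat k (m - k) u) (0\<^sub>m (m + 1) (n - k + 1))
        (0\<^sub>m (n + 1) (m - k + 1)) (conv_mat k (n - k) u) *\<^sub>v (coeff_vec (m - k) b @\<^sub>v coeff_vec (n - k) c) =
      coeff_vec m (u * b) @\<^sub>v coeff_vec n (u * c)"
    using four_block_mat_mult_vec[OF C(3) zero_carrier_mat zero_carrier_mat C(4) coeff_vec_carrier coeff_vec_carrier]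
      conv_mat_mult[OF deg(2)] conv_mat_mult[OF deg(3)] kmn
    by (simp add: zero_mat_mult_vec coeff_vec_def)
  have "J_mat m n k h u v w *\<^sub>v triple_vec m n k x =
     (mat_of_row (conjugate h) *\<^sub>v coeff_vec k a +
        0\<^sub>m 1 ((m - k + 1) + (n - k + 1)) *\<^sub>v (coeff_vec (m - k) b @\<^sub>v coeff_vec (n - k) c)) @\<^sub>v
     ((conv_mat (m - k) k v @\<^sub>r conv_mat (n - k) k w) *\<^sub>v coeff_vec k a +
      four_block_mat (conv_mat k (m - k) u) (0\<^sub>m (m + 1) (n - k + 1))
        (0\<^sub>m (n + 1) (m - k + 1)) (conv_mat k (n - k) u) *\<^sub>v (coeff_vec (m - k) b @\<^sub>v coeff_vec (n - k) c))"
    unfolding J_mat_def xabc triple_vec_def prod.case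
  proof (rule four_block_mat_mult_vec)
    show "mat_of_row (conjugate h) \<in> carrier_mat 1 (k + 1)" using h by simp
    show "conv_mat (m - k) k v @\<^sub>r conv_mat (n - k) k w \<in> carrier_mat ((m + 1) + (n + 1)) (k + 1)"
      using C by blast
    show "four_block_mat (conv_mat k (m - k) u) (0\<^sub>m (m + 1) (n - k + 1)) (0\<^sub>m (n + 1) (m - k + 1)) (conv_mat k (n - k) u)
        \<in> carrier_mat ((m + 1) + (n + 1)) ((m - k + 1) + (n - k + 1))"
      using C by (intro four_block_carrier_mat)
    show "coeff_vec (m - k) b @\<^sub>v coeff_vec (n - k) c \<in> carrier_vec ((m - k + 1) + (n - k + 1))"
      by (rule tail)
  qed (rule zero_carrier_mat coeff_vec_carrier)+
  also have "\<dots> = vec 1 (\<lambda>_. row_functional h a) @\<^sub>v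
     (coeff_vec m (u * b + v * a) @\<^sub>v coeff_vec n (u * c + w * a))"
    unfolding top mid bot zero_mat_mult_vec[OF tail] append_vec_add[OF coeff_vec_carrier coeff_vec_carrier coeff_vec_carrier coeff_vec_carrier]
      coeff_vec_add by (simp add: add.commute right_zero_vec[of _ 1])
  finally show ?thesis
    by (simp add: xabc expand_deriv_def)
qed

lemma degree_expand_deriv:
  assumes "k \<le> m" "k \<le> n" "(u, v, w) \<in> triples_upto m n k" "x \<in> triples_upto m n k"
  shows "degree (fst (expand_deriv (u, v, w) x)) \<le> m" "degree (snd (expand_deriv (u, v, w) x)) \<le> n"
  using assms by (auto simp: triples_upto_def expand_deriv_def intro!: degree_add_le
      order_trans[OF degree_mult_le])

lemma euclid_norm_J_mat:
  assumes kmn: "k \<le> m" "k \<le> n" and h: "h \<in> carrier_vec (k + 1)" and z: "(u, v, w) \<in> triples_upto m n k"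
    and x: "x \<in> triples_upto m n k"
  shows "euclid_norm (J_mat m n k h u v w *\<^sub>v triple_vec m n k x) =
     sqrt ((cmod (row_functional h (fst x)))\<^sup>2 + (pair_norm (expand_deriv (u, v, w) x))\<^sup>2)"
proof -
  have "euclid_norm (vec 1 (\<lambda>_. c)) = cmod c" for c by (simp add: euclid_norm_def)
  then show ?thesis
    unfolding J_mat_mult_triple_vec[OF kmn h x]
    using degree_expand_deriv[OF kmn z x]
    by (simp add: euclid_norm_append_vec euclid_norm_coeff_vec flip: pair_norm_Pair)
qed

text \<open>Injectivity of \<open>J\<close> enters the analysis only through this estimate: the linearization is bounded
  below by \<open>1 / \<parallel>J\<^sup>+\<parallel>\<close> on the directions that the first row annihilates.\<close>

lemma triple_norm_le_of_injective_J:
  assumes kmn: "k \<le> m" "k \<le> n" and h: "h \<in> carrier_vec (k + 1)" and z: "(u, v, w) \<in> triples_upto m n k"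
    and inj: "mat_injective (J_mat m n k h u v w)" and x: "x \<in> triples_upto m n k"
    and zero: "row_functional h (fst x) = 0"
  shows "triple_norm x \<le> mat_norm (pseudo_inverse (J_mat m n k h u v w)) *
     pair_norm (expand_deriv (u, v, w) x)"
proof -
  have "euclid_norm (J_mat m n k h u v w *\<^sub>v triple_vec m n k x) = pair_norm (expand_deriv (u, v, w) x)"
    unfolding euclid_norm_J_mat[OF kmn h z x] zero by simp
  then show ?thesis
    using euclid_norm_le_pseudo_inverse[OF J_mat_carrier[OF kmn h] inj triple_vec_carrier]
    by (metis euclid_norm_triple_vec[OF x])
qed

section \<open>Estimates for the factorization map\<close>

lemma triples_upto_diff: "x \<in> triples_upto m n k \<Longrightarrow> y \<in> triples_upto m n k \<Longrightarrow> x - y \<in> triples_upto m n k"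
  by (cases x; cases y) (auto simp: triples_upto_def intro: degree_diff_le)

lemma triples_upto_add: "x \<in> triples_upto m n k \<Longrightarrow> y \<in> triples_upto m n k \<Longrightarrow> x + y \<in> triples_upto m n k"
  by (cases x; cases y) (auto simp: triples_upto_def intro: degree_add_le)

lemma triples_upto_scale: "x \<in> triples_upto m n k \<Longrightarrow> triple_scale t x \<in> triples_upto m n k"
  by (cases x) (auto simp: triples_upto_def triple_scale_def pair_scale_def intro: order_trans[OF degree_smult_le])

text \<open>The map \<^const>\<open>expand\<close> is quadratic, so its second-order Taylor expansion is exact and has
  \<^const>\<open>expand\<close> itself as remainder.\<close>

lemma expand_add: "expand (z + x) = expand z + expand_deriv z x + expand x"
  by (cases z; cases x) (simp add: expand_def expand_deriv_def algebra_simps)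

lemma expand_deriv_add_left: "expand_deriv (z + y) x = expand_deriv z x + expand_deriv y x"
  by (cases z; cases x; cases y) (simp add: expand_deriv_def algebra_simps)

lemma pair_norm_mult_le:
  assumes "degree u \<le> k"
  shows "pair_norm (u * v, u * w) \<le> real (k + 1) * poly_norm u * pair_norm (v, w)"
proof -
  have "pair_norm (u * v, u * w) \<le>
      sqrt ((real (k + 1) * poly_norm u * poly_norm v)\<^sup>2 + (real (k + 1) * poly_norm u * poly_norm w)\<^sup>2)"
    unfolding pair_norm_Pair using poly_norm_mult_le[OF assms, of v] poly_norm_mult_le[OF assms, of w]
    by (intro real_sqrt_le_mono add_mono power_mono) auto
  also have "\<dots> = sqrt ((real (k + 1) * poly_norm u)\<^sup>2 * ((poly_norm v)\<^sup>2 + (poly_norm w)\<^sup>2))"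
    by (simp only: power_mult_distrib distrib_left)
  also have "\<dots> = real (k + 1) * poly_norm u * pair_norm (v, w)"
    by (simp add: real_sqrt_mult pair_norm_Pair)
  finally show ?thesis .
qed

lemma pair_norm_expand_le:
  assumes "x \<in> triples_upto m n k"
  shows "pair_norm (expand x) \<le> real (2 * (k + 1)) * (triple_norm x)\<^sup>2"
proof (cases x)
  case (fields u v w)
  have "pair_norm (expand x) \<le> real (k + 1) * poly_norm u * pair_norm (v, w)"
    using assms pair_norm_mult_le[of u k] by (simp add: fields expand_def triples_upto_def)
  also have "\<dots> \<le> real (k + 1) * triple_norm x * triple_norm x"
    unfolding fields by (intro mult_mono poly_norm_le_triple_norm pair_norm_le_triple_norm) auto
  also have "\<dots> \<le> real (2 * (k + 1)) * (triple_norm x)\<^sup>2"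
    by (simp add: power2_eq_square algebra_simps)
  finally show ?thesis .
qed

lemma pair_norm_expand_deriv_le:
  assumes "z \<in> triples_upto m n k" "x \<in> triples_upto m n k"
  shows "pair_norm (expand_deriv z x) \<le> real (2 * (k + 1)) * triple_norm z * triple_norm x"
proof (cases z; cases x)
  fix u v w a b c assume z: "z = (u, v, w)" and x: "x = (a, b, c)"
  have "expand_deriv z x = (u * b, u * c) + (a * v, a * w)"
    by (simp add: z x expand_deriv_def mult.commute)
  then have "pair_norm (expand_deriv z x) \<le> pair_norm (u * b, u * c) + pair_norm (a * v, a * w)"
    by (simp only: pair_norm_triangle)
  also have "\<dots> \<le> real (k + 1) * poly_norm u * pair_norm (b, c) + real (k + 1) * poly_norm a * pair_norm (v, w)"
    using assms by (intro add_mono pair_norm_mult_le) (auto simp: z x triples_upto_def)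
  also have "\<dots> \<le> real (k + 1) * triple_norm z * triple_norm x + real (k + 1) * triple_norm x * triple_norm z"
    unfolding z x by (intro add_mono mult_mono poly_norm_le_triple_norm pair_norm_le_triple_norm) auto
  also have "\<dots> = real (2 * (k + 1)) * triple_norm z * triple_norm x"
    by (simp add: algebra_simps)
  finally show ?thesis .
qed

lemma mult_segment:
  fixes u1 u2 v1 v2 c :: cpoly
  shows "(smult (of_real (1 - t)) u1 + smult (of_real t) u2) * (smult (of_real (1 - t)) v1 + smult (of_real t) v2) - c =
    smult (of_real (1 - t)) (u1 * v1 - c) + smult (of_real t) (u2 * v2 - c) -
    smult (of_real (t * (1 - t))) ((u1 - u2) * (v1 - v2))"
proof -
  define T :: cpoly where "T = [:of_real t:]"
  have sm: "smult (of_real t) p = T * p" "smult (of_real (1 - t)) p = (1 - T) * p"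
    "smult (of_real (t * (1 - t))) p = T * (1 - T) * p" for p
    by (simp_all add: T_def one_pCons algebra_simps smult_diff_left)
  show ?thesis
    unfolding sm by (simp add: algebra_simps)
qed

text \<open>On a segment, \<^const>\<open>expand\<close> differs from affine interpolation only by a second-order term.
  This is what makes Stewart's identity applicable to distances in the image.\<close>

lemma expand_segment:
  "expand (triple_scale (1 - t) x + triple_scale t y) - c =
     pair_scale (1 - t) (expand x - c) + pair_scale t (expand y - c) -
     pair_scale (t * (1 - t)) (expand (x - y))"
  by (cases x; cases y; cases c)
     (simp add: expand_def triple_scale_def pair_scale_def mult_segment del: of_real_diff of_real_mult)

lemma triple_segment_diff:
  "triple_scale (1 - t) x + triple_scale t y - z = triple_scale (1 - t) (x - z) + triple_scale t (y - z)"
  by (cases x; cases y; cases z)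
     (simp add: triple_scale_def pair_scale_def smult_diff_right smult_diff_left)

lemma triple_norm_segment_le:
  assumes "triple_norm (x - z) \<le> \<rho>" "triple_norm (y - z) \<le> \<rho>" "0 \<le> t" "t \<le> 1"
  shows "triple_norm (triple_scale (1 - t) x + triple_scale t y - z) \<le> \<rho>"
proof -
  have "triple_norm (triple_scale (1 - t) x + triple_scale t y - z) \<le>
      (1 - t) * triple_norm (x - z) + t * triple_norm (y - z)"
    unfolding triple_segment_diff
    using triple_norm_triangle[of "triple_scale (1 - t) (x - z)" "triple_scale t (y - z)"] assms
    by (simp add: triple_norm_scale)
  also have "\<dots> \<le> (1 - t) * \<rho> + t * \<rho>"
    using assms by (intro add_mono mult_left_mono) auto
  finally show ?thesis by (simp add: algebra_simps)
qed

lemma row_functional_simps: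
  "row_functional h (u + v) = row_functional h u + row_functional h v"
  "row_functional h (u - v) = row_functional h u - row_functional h v"
  "row_functional h (smult c u) = c * row_functional h u"
  by (simp_all add: row_functional_def sum.distrib sum_subtractf sum_distrib_left algebra_simps)

lemma row_functional_tendsto:
  "coeffs_tendsto f p \<Longrightarrow> (\<lambda>i. row_functional h (f i)) \<longlonglongrightarrow> row_functional h p"
  unfolding row_functional_def coeffs_tendsto_def by (intro tendsto_intros) auto

lemma bounded_triples_subseq:
  fixes z :: "nat \<Rightarrow> cpoly \<times> cpoly \<times> cpoly"
  assumes T: "\<And>i. z i \<in> triples_upto m n k" and B: "\<And>i. triple_norm (z i) \<le> B"
  obtains \<sigma> z' where "strict_mono \<sigma>" "z' \<in> triples_upto m n k"
    "(\<lambda>i. triple_norm (z (\<sigma> i) - z')) \<longlonglongrightarrow> 0"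
proof -
  define u where "u i = fst (z i)" for i
  define v where "v i = fst (snd (z i))" for i
  define w where "w i = snd (snd (z i))" for i
  have z: "z i = (u i, v i, w i)" for i by (simp add: u_def v_def w_def)
  have deg: "degree (u i) \<le> k" "degree (v i) \<le> m - k" "degree (w i) \<le> n - k" for i
    using T[of i] by (auto simp: z triples_upto_def)
  have nrm: "poly_norm (u i) \<le> B" "poly_norm (v i) \<le> B" "poly_norm (w i) \<le> B" for i
    using B[of i] poly_norm_le_triple_norm[of "u i" "(v i, w i)"] pair_norm_le_triple_norm[of "(v i, w i)" "u i"]
      poly_norm_fst_le[of "(v i, w i)"] poly_norm_snd_le[of "(v i, w i)"] by (auto simp: z)
  obtain \<sigma> u' v' w' where \<sigma>: "strict_mono \<sigma>" and lims: "coeffs_tendsto (\<lambda>i. u (\<sigma> i)) u'"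
    "coeffs_tendsto (\<lambda>i. v (\<sigma> i)) v'" "coeffs_tendsto (\<lambda>i. w (\<sigma> i)) w'"
    by (rule bounded_poly_triples_subseq[OF deg nrm])
  have "(\<lambda>i. poly_norm (u (\<sigma> i) - u') + poly_norm (v (\<sigma> i) - v') + poly_norm (w (\<sigma> i) - w')) \<longlonglongrightarrow> 0 + 0 + 0"
    by (intro tendsto_add coeffs_tendsto_poly_norm_diff[OF lims(1) deg(1)]
        coeffs_tendsto_poly_norm_diff[OF lims(2) deg(2)] coeffs_tendsto_poly_norm_diff[OF lims(3) deg(3)])
  then have "(\<lambda>i. poly_norm (u (\<sigma> i) - u') + poly_norm (v (\<sigma> i) - v') + poly_norm (w (\<sigma> i) - w')) \<longlonglongrightarrow> 0"
    by simp
  then have "(\<lambda>i. triple_norm (z (\<sigma> i) - (u', v', w'))) \<longlonglongrightarrow> 0"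
    by (rule LIMSEQ_null_comparison[rotated])
       (simp add: z triple_norm_le_add)
  moreover have "degree u' \<le> k" "degree v' \<le> m - k" "degree w' \<le> n - k"
    by (rule coeffs_tendsto_degree_le[OF lims(1) deg(1)], rule coeffs_tendsto_degree_le[OF lims(2) deg(2)],
        rule coeffs_tendsto_degree_le[OF lims(3) deg(3)])
  ultimately show ?thesis
    using that[OF \<sigma>, of "(u', v', w')"] by (simp add: triples_upto_def)
qed

lemma gcd_dist_le:
  assumes "rs \<in> pairs_gcd_degree m n k"
  shows "gcd_dist m n k pq \<le> pair_norm (pq - rs)"
  unfolding gcd_dist_def by (rule cINF_lower[OF bdd_belowI2[of _ 0] assms]) simp

text \<open>Here \<open>s\<close> and \<open>\<delta>\<close> are the distances of a point to the start and the end of a path, \<open>G\<close> is the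
  distance between start and end, and the path deviates from the straight segment by at most
  \<open>t (1 - t) q\<close>.  If no point of the path is closer than the start, the triangle has an almost right or
  obtuse angle there, and \<open>\<delta>\<close> is its longest side up to an error governed by \<open>q\<close>.  The inequality is
  the limiting case \<open>t \<rightarrow> 0\<close>, reached through the factor \<open>x = 1 - t\<close>.\<close>

lemma le_sum_squares_from_segments:
  fixes s \<delta> G q :: real
  assumes seg: "\<And>t. 0 < t \<Longrightarrow> t < 1 \<Longrightarrow> \<exists>A\<ge>0. A\<^sup>2 = (1 - t) * s\<^sup>2 + t * \<delta>\<^sup>2 - t * (1 - t) * G\<^sup>2 \<and>
      s \<le> A + t * (1 - t) * q"
    and s: "0 \<le> s"
  shows "G\<^sup>2 \<le> \<delta>\<^sup>2 + q\<^sup>2"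
proof (rule field_le_mult_one_interval)
  fix x :: real assume x: "0 < x" "x < 1"
  define t where "t = 1 - x"
  have t: "0 < t" "t < 1" using x by (auto simp: t_def)
  from seg[OF t] obtain A where A: "A \<ge> 0" "A\<^sup>2 = (1 - t) * s\<^sup>2 + t * \<delta>\<^sup>2 - t * (1 - t) * G\<^sup>2"
    "s \<le> A + t * (1 - t) * q" by blast
  define c where "c = t * (1 - t) * q"
  have "s\<^sup>2 - 2 * s * c \<le> A\<^sup>2"
  proof (cases "c \<le> s")
    case True
    then have "(s - c)\<^sup>2 \<le> A\<^sup>2" using A(3) by (intro power_mono) (auto simp: c_def)
    moreover have "0 \<le> c\<^sup>2" by simp
    ultimately show ?thesis unfolding power2_diff by linarith
  next
    case False
    then have "s * s \<le> s * (2 * c)" using s by (intro mult_left_mono) auto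
    then have "s\<^sup>2 - 2 * s * c \<le> 0" by (simp add: power2_eq_square)
    also have "0 \<le> A\<^sup>2" by simp
    finally show ?thesis .
  qed
  then have "t * ((1 - t) * G\<^sup>2) \<le> t * (\<delta>\<^sup>2 - s\<^sup>2 + 2 * s * (1 - t) * q)"
    unfolding A(2) c_def by (simp add: algebra_simps)
  then have "(1 - t) * G\<^sup>2 \<le> \<delta>\<^sup>2 - s\<^sup>2 + 2 * s * ((1 - t) * q)"
    using t by (simp add: mult.assoc)
  also have "\<dots> \<le> \<delta>\<^sup>2 + ((1 - t) * q)\<^sup>2"
    using zero_le_power2[of "s - (1 - t) * q"] by (simp add: power2_diff)
  also have "((1 - t) * q)\<^sup>2 \<le> q\<^sup>2"
    unfolding power_mult_distrib using t by (intro mult_left_le_one_le power_le_one) auto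
  finally show "x * G\<^sup>2 \<le> \<delta>\<^sup>2 + q\<^sup>2" by (simp add: t_def)
qed

section \<open>Local geometry near a regular factorization\<close>

text \<open>A representative of the class of exact GCDs of \<open>pq0\<close>, together with a normalization \<open>h\<close> of the scaling
  for which the Jacobian at this representative is injective.\<close>

locale regular_factorization =
  fixes m n k :: nat and h :: "complex vec" and pq0 :: "cpoly \<times> cpoly" and u0 v0 w0 :: cpoly
  assumes pq0: "pq0 \<in> pairs_gcd_degree m n k"
    and triple: "(u0, v0, w0) \<in> gcd_triples pq0"
    and h: "h \<in> carrier_vec (k + 1)"
    and inj: "mat_injective (J_mat m n k h u0 v0 w0)"
begin

abbreviation "T \<equiv> triples_upto m n k"
abbreviation "z0 \<equiv> (u0, v0, w0)"

definition \<kappa> :: real where "\<kappa> = mat_norm (pseudo_inverse (J_mat m n k h u0 v0 w0))"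

text \<open>A common norm bound for the quadratic map \<^const>\<open>expand\<close> and its polarization.\<close>

definition K :: real where "K = real (2 * (k + 1))"

lemma K_pos: "0 < K" by (simp add: K_def)

lemma pair_norm_expand_le_K: "x \<in> T \<Longrightarrow> pair_norm (expand x) \<le> K * (triple_norm x)\<^sup>2"
  unfolding K_def by (rule pair_norm_expand_le)

lemma k_le: "k \<le> m" "k \<le> n"
  using pairs_gcd_degree_bound[OF pq0] by auto

lemma z0_in: "z0 \<in> T"
  using gcd_triples_degrees[OF pq0 triple] by (simp add: triples_upto_def)

lemma expand_z0: "expand z0 = pq0"
  using triple by (simp add: gcd_triples_def expand_def)

lemma coercive:
  assumes "x \<in> T" "row_functional h (fst x) = 0"
  shows "triple_norm x \<le> \<kappa> * pair_norm (expand_deriv z0 x)"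
  unfolding \<kappa>_def using triple_norm_le_of_injective_J[OF k_le h z0_in inj assms] .

lemma \<kappa>_pos: "0 < \<kappa>"
proof -
  have "triple_norm (0, 1, 0) \<le> \<kappa> * pair_norm (expand_deriv z0 (0, 1, 0))"
    by (rule coercive) (simp_all add: triples_upto_def row_functional_def)
  moreover have "triple_norm (0, 1, 0) = 1"
    by (simp add: triple_norm_def poly_norm_def)
  ultimately have "\<not> \<kappa> \<le> 0"
    using mult_nonpos_nonneg[of \<kappa> "pair_norm (expand_deriv z0 (0, 1, 0))"] by auto
  then show ?thesis by simp
qed

text \<open>The direction \<open>(u0, - v0, - w0)\<close>, tangent to the rescalings of the factorization, lies in the kernel
  of the linearization, so only the first row of \<open>J\<close> can prevent it from being annihilated.\<close>

lemma row_functional_u0: "row_functional h u0 \<noteq> 0"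
proof
  assume "row_functional h u0 = 0"
  then have "triple_norm (u0, - v0, - w0) \<le> \<kappa> * pair_norm (expand_deriv z0 (u0, - v0, - w0))"
    using z0_in by (intro coercive) (auto simp: triples_upto_def)
  also have "expand_deriv z0 (u0, - v0, - w0) = 0"
    by (simp add: expand_deriv_def mult.commute zero_prod_def)
  also have "\<kappa> * pair_norm 0 = 0"
    by simp
  finally have "triple_norm (u0, - v0, - w0) = 0"
    by (rule antisym) simp
  then have "u0 = 0"
    by (simp only: triple_norm_eq_0_iff) (simp add: zero_prod_def)
  then show False using gcd_triples_degrees[OF pq0 triple] by simp
qed

lemma pair_norm_expand_diff_le:
  assumes "z \<in> T" "y \<in> T"
  shows "pair_norm (expand z - expand y) \<le> K * (triple_norm y + triple_norm (z - y)) * triple_norm (z - y)"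
proof -
  have "expand z - expand y = expand_deriv y (z - y) + expand (z - y)"
    using expand_add[of y "z - y"] by simp
  then have "pair_norm (expand z - expand y) \<le> pair_norm (expand_deriv y (z - y)) + pair_norm (expand (z - y))"
    by (simp only: pair_norm_triangle)
  also have "\<dots> \<le> K * triple_norm y * triple_norm (z - y) + K * (triple_norm (z - y))\<^sup>2"
    unfolding K_def using assms
    by (intro add_mono pair_norm_expand_deriv_le pair_norm_expand_le triples_upto_diff)
  finally show ?thesis by (simp add: power2_eq_square algebra_simps)
qed

text \<open>On a small ball the second-order terms and the variation of the derivative consume at most half of
  the lower bound at the centre, so on each slice of constant first row \<^const>\<open>expand\<close> is injective
  with a Lipschitz inverse.  The error terms add up to \<open>3 K \<rho>\<close> times the distance, whence the constant 6.\<close>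

lemma expand_inverse_lipschitz:
  assumes z: "z1 \<in> T" "z2 \<in> T" "triple_norm (z1 - z0) \<le> \<rho>" "triple_norm (z2 - z0) \<le> \<rho>"
    and row: "row_functional h (fst z1) = row_functional h (fst z2)"
    and \<rho>: "6 * \<kappa> * K * \<rho> \<le> 1"
  shows "triple_norm (z1 - z2) \<le> 2 * \<kappa> * pair_norm (expand z1 - expand z2)"
proof -
  define x where "x = z1 - z2"
  define d where "d = triple_norm x"
  have xT: "x \<in> T" and yT: "z2 - z0 \<in> T"
    using z z0_in by (auto simp: x_def triples_upto_diff)
  have d0: "0 \<le> d" and d2: "d \<le> 2 * \<rho>"
    using triple_norm_diff_triangle[of z1 z2 z0] z(3,4) triple_norm_minus_commute[of z0 z2]
    by (auto simp: d_def x_def)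
  have "expand_deriv z0 x = (expand z1 - expand z2) + - (expand_deriv (z2 - z0) x + expand x)"
    using expand_add[of z2 x] expand_deriv_add_left[of z0 "z2 - z0" x] by (simp add: x_def algebra_simps)
  then have "pair_norm (expand_deriv z0 x) \<le>
      pair_norm (expand z1 - expand z2) + pair_norm (expand_deriv (z2 - z0) x + expand x)"
    using pair_norm_triangle pair_norm_uminus by metis
  also have "pair_norm (expand_deriv (z2 - z0) x + expand x) \<le>
      pair_norm (expand_deriv (z2 - z0) x) + pair_norm (expand x)"
    by (rule pair_norm_triangle)
  also have "\<dots> \<le> K * \<rho> * d + K * (2 * \<rho>) * d"
  proof (intro add_mono)
    have "pair_norm (expand_deriv (z2 - z0) x) \<le> K * triple_norm (z2 - z0) * d"
      unfolding K_def d_def by (rule pair_norm_expand_deriv_le[OF yT xT])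
    also have "\<dots> \<le> K * \<rho> * d"
      using z(4) d0 K_pos by (intro mult_right_mono mult_left_mono) auto
    finally show "pair_norm (expand_deriv (z2 - z0) x) \<le> K * \<rho> * d" .
    have "pair_norm (expand x) \<le> K * d * d"
      using pair_norm_expand_le[OF xT] by (simp only: K_def d_def power2_eq_square mult.assoc)
    also have "\<dots> \<le> K * (2 * \<rho>) * d"
      using d2 d0 K_pos by (intro mult_right_mono mult_left_mono) auto
    finally show "pair_norm (expand x) \<le> K * (2 * \<rho>) * d" .
  qed
  finally have "pair_norm (expand_deriv z0 x) \<le> pair_norm (expand z1 - expand z2) + 3 * K * \<rho> * d"
    by (simp add: algebra_simps)
  then have "\<kappa> * pair_norm (expand_deriv z0 x) \<le> \<kappa> * (pair_norm (expand z1 - expand z2) + 3 * K * \<rho> * d)"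
    using \<kappa>_pos by (intro mult_left_mono) auto
  moreover have "d \<le> \<kappa> * pair_norm (expand_deriv z0 x)"
    unfolding d_def using row by (intro coercive[OF xT]) (simp add: x_def row_functional_simps)
  moreover have "6 * \<kappa> * K * \<rho> * d \<le> 1 * d"
    using \<rho> d0 by (intro mult_right_mono)
  ultimately show ?thesis
    by (simp add: x_def d_def algebra_simps)
qed

text \<open>A product triple near the centre has a GCD of degree at least \<open>k\<close> by construction and of degree at
  most \<open>k\<close> by semicontinuity.\<close>

lemma expand_near_in_variety:
  obtains \<rho> where "\<rho> > 0"
    "\<And>z. z \<in> T \<Longrightarrow> triple_norm (z - z0) \<le> \<rho> \<Longrightarrow> expand z \<in> pairs_gcd_degree m n k"
proof -
  obtain r1 where r1: "r1 > 0"
    "\<And>pq. pq \<in> pairs_upto m n \<Longrightarrow> pair_norm (pq - pq0) < r1 \<Longrightarrow> pq \<in> pairs_exact m n"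
    using pairs_exact_open[of pq0 m n] pq0 by (auto simp: pairs_gcd_degree_def)
  obtain r2 where r2: "r2 > 0"
    "\<And>j rs. k < j \<Longrightarrow> rs \<in> pairs_gcd_degree m n j \<Longrightarrow> r2 \<le> pair_norm (rs - pq0)"
    using gcd_degree_upper_semicontinuous[OF pq0] by blast
  define R where "R = min r1 r2"
  define L where "L = K * (triple_norm z0 + 1)"
  have R: "R > 0" using r1 r2 by (simp add: R_def)
  have L: "L > 0" using K_pos by (auto simp: L_def intro!: mult_pos_pos add_nonneg_pos)
  \<comment> \<open>On the ball of radius 1, \<open>L\<close> bounds the ratio of the distances to \<open>pq0\<close> and to \<open>z0\<close>.\<close>
  define \<rho> where "\<rho> = min 1 (R / (L + 1))"
  show ?thesis
  proof (rule that[of \<rho>])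
    show "0 < \<rho>" using R L by (simp add: \<rho>_def)
    fix z assume z: "z \<in> T" "triple_norm (z - z0) \<le> \<rho>"
    have "pair_norm (expand z - pq0) \<le> K * (triple_norm z0 + triple_norm (z - z0)) * triple_norm (z - z0)"
      using pair_norm_expand_diff_le[OF z(1) z0_in] expand_z0 by simp
    also have "\<dots> \<le> L * \<rho>"
      unfolding L_def using z(2) K_pos by (intro mult_mono add_mono) (auto simp: \<rho>_def)
    also have "\<dots> \<le> L * (R / (L + 1))"
      using L by (intro mult_left_mono) (auto simp: \<rho>_def)
    also have "\<dots> < R"
      using L R by (simp add: divide_simps)
    finally have close: "pair_norm (expand z - pq0) < R" .
    obtain u v w where uvw: "z = (u, v, w)" by (cases z)
    have deg: "degree u \<le> k" "degree v \<le> m - k" "degree w \<le> n - k"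
      using z(1) by (auto simp: uvw triples_upto_def)
    have "expand z \<in> pairs_upto m n"
      using deg k_le by (auto simp: uvw expand_def pairs_upto_def intro!: order_trans[OF degree_mult_le])
    with close have "expand z \<in> pairs_exact m n"
      by (intro r1(2)) (auto simp: R_def)
    then have nz: "u * v \<noteq> 0" "u * w \<noteq> 0" and degs: "degree (u * v) = m" "degree (u * w) = n"
      by (auto simp: uvw expand_def pairs_exact_def)
    have "degree u = k"
      using nz degs deg k_le by (simp add: degree_mult_eq)
    let ?j = "degree (gcd (u * v) (u * w))"
    have in_j: "expand z \<in> pairs_gcd_degree m n ?j"
      using nz degs unfolding uvw expand_def prod.case pairs_gcd_degree_iff by blast
    have "u dvd gcd (u * v) (u * w)"
      by (intro gcd_greatest) auto
    then have "k \<le> ?j"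
      using dvd_imp_degree_le[of u "gcd (u * v) (u * w)"] nz \<open>degree u = k\<close> by (metis gcd_eq_0_iff)
    moreover have "\<not> k < ?j"
      using r2(2)[OF _ in_j] close by (auto simp: R_def)
    ultimately show "expand z \<in> pairs_gcd_degree m n k"
      using in_j by simp
  qed
qed

text \<open>Conversely, the factorization depends continuously on the pair.  Normalized factorizations of
  pairs tending to \<open>pq0\<close> have a limit point, which is a factorization of \<open>pq0\<close> and thus a rescaling of the
  given one; rescaling them to the prescribed value of the first row makes them converge to it.\<close>

lemma nearby_pairs_factor_nearby:
  assumes "\<rho> > 0"
  obtains r where "r > 0" "\<And>rs. rs \<in> pairs_gcd_degree m n k \<Longrightarrow> pair_norm (rs - pq0) < r \<Longrightarrow>
    \<exists>z\<in>T. triple_norm (z - z0) < \<rho> \<and> row_functional h (fst z) = row_functional h u0 \<and> expand z = rs"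
proof -
  obtain p0 q0 where pq: "pq0 = (p0, q0)" by (cases pq0)
  have exact: "(p0, q0) \<in> pairs_exact m n"
    using pq0 by (simp add: pq pairs_gcd_degree_def)
  define good where "good rs \<longleftrightarrow> (\<exists>z\<in>T. triple_norm (z - z0) < \<rho> \<and>
      row_functional h (fst z) = row_functional h u0 \<and> expand z = rs)" for rs
  have "\<exists>r>0. \<forall>rs\<in>pairs_gcd_degree m n k. pair_norm (rs - pq0) < r \<longrightarrow> good rs"
  proof (rule ccontr)
    assume neg: "\<not> ?thesis"
    have "\<exists>u v w. degree u \<le> k \<and> degree v \<le> m - k \<and> degree w \<le> n - k \<and> poly_norm u = 1 \<and>
        pair_norm ((u * v, u * w) - pq0) \<le> 1 / real (Suc i) \<and> \<not> good (u * v, u * w)" for i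
    proof -
      have "0 < 1 / real (Suc i)" by simp
      with neg obtain rs where rs: "rs \<in> pairs_gcd_degree m n k" "pair_norm (rs - pq0) < 1 / real (Suc i)" "\<not> good rs"
        by blast
      then obtain u v w where uvw: "(u, v, w) \<in> gcd_triples rs" "poly_norm u = 1"
        using gcd_factorization_normalized by blast
      then have "rs = (u * v, u * w)" by (simp add: gcd_triples_def)
      then show ?thesis
        using rs(2,3) gcd_triples_degrees[OF rs(1) uvw(1)] uvw(2)
        by (intro exI[of _ u] exI[of _ v] exI[of _ w]) simp
    qed
    then obtain u v w where deg: "\<And>i. degree (u i) \<le> k" "\<And>i. degree (v i) \<le> m - k" "\<And>i. degree (w i) \<le> n - k"
      and nrm: "\<And>i. poly_norm (u i) = 1"
      and small: "\<And>i. pair_norm ((u i * v i, u i * w i) - pq0) \<le> 1 / real (Suc i)"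
      and bad: "\<And>i. \<not> good (u i * v i, u i * w i)"
      by metis
    have lim: "(\<lambda>i. pair_norm ((u i * v i, u i * w i) - (p0, q0))) \<longlonglongrightarrow> 0"
      unfolding pq[symmetric]
      by (rule LIMSEQ_null_comparison[OF _ LIMSEQ_one_over_Suc]) (use small in simp)
    obtain \<sigma> u' v' w' where \<sigma>: "strict_mono \<sigma>"
      and lims: "coeffs_tendsto (\<lambda>i. u (\<sigma> i)) u'" "coeffs_tendsto (\<lambda>i. v (\<sigma> i)) v'" "coeffs_tendsto (\<lambda>i. w (\<sigma> i)) w'"
      and prod: "u' * v' = p0" "u' * w' = q0" and degu': "degree u' = k"
      by (rule factorizations_subseq[OF exact k_le deg nrm lim])
    have p0: "p0 \<noteq> 0" and gk: "degree (gcd p0 q0) = k"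
      using pq0 by (auto simp: pq pairs_gcd_degree_iff)
    have "u' \<in> gcds pq0"
      unfolding pq using in_gcds_iff[OF p0, of u' q0] prod degu' gk by auto
    moreover have "u0 \<in> gcds pq0"
      using triple by (simp add: gcd_triples_def)
    ultimately have "u0 \<sim>\<^sub>p u'"
      using gcds_eq_class_of_member[of u' pq0] p0 by (auto simp: pq)
    then obtain a where a: "a \<noteq> 0" "u0 = smult a u'"
      by (auto simp: poly_sim_def)
    have "u' \<noteq> 0" using prod p0 by auto
    have "u0 * v0 = p0" "u0 * w0 = q0"
      using triple by (auto simp: gcd_triples_def pq)
    then have "u' * smult a v0 = u' * v'" "u' * smult a w0 = u' * w'"
      using prod a by auto
    then have "v' = smult a v0" "w' = smult a w0"
      using \<open>u' \<noteq> 0\<close> by (metis mult_left_cancel)+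
    then have vw: "v0 = smult (inverse a) v'" "w0 = smult (inverse a) w'"
      using a(1) by simp_all
    \<comment> \<open>The factors that give the rescaled GCDs the same first-row value as \<open>u0\<close>.\<close>
    define c where "c i = row_functional h u0 / row_functional h (u (\<sigma> i))" for i
    have row: "row_functional h u0 = a * row_functional h u'"
      by (simp add: a row_functional_simps)
    then have row': "row_functional h u' \<noteq> 0"
      using row_functional_u0 by auto
    have rowlim: "(\<lambda>i. row_functional h (u (\<sigma> i))) \<longlonglongrightarrow> row_functional h u'"
      by (rule row_functional_tendsto[OF lims(1)])
    have "c \<longlonglongrightarrow> row_functional h u0 / row_functional h u'"
      unfolding c_def by (intro tendsto_intros rowlim row')
    then have c: "c \<longlonglongrightarrow> a" using row row' by simp
    then have c': "(\<lambda>i. inverse (c i)) \<longlonglongrightarrow> inverse a"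
      using a by (intro tendsto_inverse)
    define z where "z i = (smult (c i) (u (\<sigma> i)), smult (inverse (c i)) (v (\<sigma> i)), smult (inverse (c i)) (w (\<sigma> i)))" for i
    have zT: "z i \<in> T" for i
      using deg by (auto simp: z_def triples_upto_def intro: order_trans[OF degree_smult_le])
    have "(\<lambda>i. poly_norm (smult (c i) (u (\<sigma> i)) - u0) + poly_norm (smult (inverse (c i)) (v (\<sigma> i)) - v0) +
        poly_norm (smult (inverse (c i)) (w (\<sigma> i)) - w0)) \<longlonglongrightarrow> 0 + 0 + 0"
      unfolding a(2) vw
      by (intro tendsto_add coeffs_tendsto_poly_norm_diff[OF coeffs_tendsto_smult[OF c lims(1)]]
          coeffs_tendsto_poly_norm_diff[OF coeffs_tendsto_smult[OF c' lims(2)]]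
          coeffs_tendsto_poly_norm_diff[OF coeffs_tendsto_smult[OF c' lims(3)]])
         (rule order_trans[OF degree_smult_le], rule deg)+
    then have "(\<lambda>i. poly_norm (smult (c i) (u (\<sigma> i)) - u0) + poly_norm (smult (inverse (c i)) (v (\<sigma> i)) - v0) +
        poly_norm (smult (inverse (c i)) (w (\<sigma> i)) - w0)) \<longlonglongrightarrow> 0" by simp
    then have "(\<lambda>i. triple_norm (z i - z0)) \<longlonglongrightarrow> 0"
      by (rule LIMSEQ_null_comparison[rotated]) (simp add: z_def triple_norm_le_add)
    then have "\<forall>\<^sub>F i in sequentially. triple_norm (z i - z0) < \<rho>"
      using assms by (rule order_tendstoD(2))
    moreover have "\<forall>\<^sub>F i in sequentially. row_functional h (u (\<sigma> i)) \<noteq> 0"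
      by (rule tendsto_imp_eventually_ne[OF rowlim row'])
    ultimately have "\<forall>\<^sub>F i in sequentially. triple_norm (z i - z0) < \<rho> \<and> row_functional h (u (\<sigma> i)) \<noteq> 0"
      by (rule eventually_conj)
    then obtain i where i: "triple_norm (z i - z0) < \<rho>" "row_functional h (u (\<sigma> i)) \<noteq> 0"
      using eventually_happens'[OF sequentially_bot] by blast
    have "c i \<noteq> 0" using i row_functional_u0 by (simp add: c_def)
    then have "expand (z i) = (u (\<sigma> i) * v (\<sigma> i), u (\<sigma> i) * w (\<sigma> i))"
      by (simp add: z_def expand_def)
    moreover have "row_functional h (fst (z i)) = row_functional h u0"
      using i by (simp add: z_def row_functional_simps c_def)
    ultimately have "good (u (\<sigma> i) * v (\<sigma> i), u (\<sigma> i) * w (\<sigma> i))"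
      unfolding good_def using i zT by blast
    with bad show False by blast
  qed
  with that show ?thesis unfolding good_def by blast
qed

text \<open>Up to a radius of this kind all estimates hold simultaneously.  The slices of the ball are convex,
  so they contain the segments along which nearest points are compared.\<close>

definition admissible_radius :: "real \<Rightarrow> bool" where
  "admissible_radius \<rho> \<longleftrightarrow> 0 < \<rho> \<and> 6 * \<kappa> * K * \<rho> \<le> 1 \<and>
     (\<forall>z\<in>T. triple_norm (z - z0) \<le> \<rho> \<longrightarrow> expand z \<in> pairs_gcd_degree m n k)"

lemma radius_pos: "admissible_radius \<rho> \<Longrightarrow> 0 < \<rho>"
  and radius_small: "admissible_radius \<rho> \<Longrightarrow> 6 * \<kappa> * K * \<rho> \<le> 1"
  and in_variety: "admissible_radius \<rho> \<Longrightarrow> z \<in> T \<Longrightarrow> triple_norm (z - z0) \<le> \<rho> \<Longrightarrow>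
    expand z \<in> pairs_gcd_degree m n k"
  by (auto simp: admissible_radius_def)

lemma admissible_radius_exists: "\<exists>\<rho>. admissible_radius \<rho>"
proof -
  obtain \<rho>1 where \<rho>1: "\<rho>1 > 0"
    "\<And>z. z \<in> T \<Longrightarrow> triple_norm (z - z0) \<le> \<rho>1 \<Longrightarrow> expand z \<in> pairs_gcd_degree m n k"
    using expand_near_in_variety by blast
  define \<rho> where "\<rho> = min \<rho>1 (1 / (6 * \<kappa> * K))"
  have pos: "0 < 6 * \<kappa> * K" using \<kappa>_pos K_pos by simp
  have "6 * \<kappa> * K * \<rho> \<le> 6 * \<kappa> * K * (1 / (6 * \<kappa> * K))"
    using pos by (intro mult_left_mono) (auto simp: \<rho>_def)
  also have "\<dots> = 1" using \<kappa>_pos K_pos by simp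
  finally have "admissible_radius \<rho>"
    using pos \<rho>1 by (auto simp: admissible_radius_def \<rho>_def)
  then show ?thesis by blast
qed

lemma gcd_dist_le_expand:
  assumes "admissible_radius \<rho>" "z \<in> T" "triple_norm (z - z0) \<le> \<rho>"
  shows "gcd_dist m n k pq \<le> pair_norm (expand z - pq)"
  unfolding pair_norm_minus_commute[of "expand z"] by (rule gcd_dist_le[OF in_variety[OF assms]])

lemma gcd_dist_nonneg: "0 \<le> gcd_dist m n k pq"
  unfolding gcd_dist_def using pq0 by (intro cINF_greatest) auto

text \<open>The set of all pairs with a GCD of degree \<open>k\<close> need not be closed, but a minimizing sequence eventually
  stays within distance \<open>r1\<close> of \<open>pq0\<close> and lifts to a bounded sequence of factorizations.  A limit of
  these stays in the closed ball, where \<^const>\<open>expand\<close> does not leave that set.\<close>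

lemma nearest_pair_attained:
  assumes \<rho>: "admissible_radius \<rho>"
    and r1: "\<And>rs. rs \<in> pairs_gcd_degree m n k \<Longrightarrow> pair_norm (rs - pq0) < r1 \<Longrightarrow>
      \<exists>z\<in>T. triple_norm (z - z0) < \<rho> \<and> row_functional h (fst z) = row_functional h u0 \<and> expand z = rs"
    and close: "2 * pair_norm (pq - pq0) < r1"
  shows "\<exists>z\<in>T. triple_norm (z - z0) \<le> \<rho> \<and> row_functional h (fst z) = row_functional h u0 \<and>
    pair_norm (expand z - pq) = gcd_dist m n k pq"
proof -
  define \<delta> where "\<delta> = pair_norm (pq - pq0)"
  define s where "s = gcd_dist m n k pq"
  have \<delta>: "2 * \<delta> < r1" using close by (simp add: \<delta>_def)
  have s_le: "s \<le> \<delta>" unfolding s_def \<delta>_def using gcd_dist_le[OF pq0] .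
  note s_low = gcd_dist_le_expand[OF \<rho>, of _ pq, folded s_def]
  have "\<exists>z\<in>T. triple_norm (z - z0) < \<rho> \<and> row_functional h (fst z) = row_functional h u0 \<and>
      pair_norm (expand z - pq) \<le> s + 1 / real (Suc i)" for i
  proof -
    \<comment> \<open>The second slack keeps the approximating pairs within distance \<open>r1\<close> of \<open>pq0\<close>.\<close>
    define \<eta> where "\<eta> = min (1 / real (Suc i)) (r1 - 2 * \<delta>)"
    have "s < s + \<eta>" using \<delta> by (simp add: \<eta>_def)
    then obtain rs where rs: "rs \<in> pairs_gcd_degree m n k" "pair_norm (pq - rs) < s + \<eta>"
      unfolding s_def gcd_dist_def using pq0 by (subst (asm) cINF_less_iff) (auto intro!: bdd_belowI2[of _ 0])
    have "pair_norm (rs - pq0) \<le> pair_norm (rs - pq) + \<delta>"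
      unfolding \<delta>_def by (rule pair_norm_diff_triangle)
    also have "\<dots> < r1"
      using rs(2) s_le pair_norm_minus_commute[of rs pq] by (simp add: \<eta>_def)
    finally obtain z where "z \<in> T" "triple_norm (z - z0) < \<rho>"
      "row_functional h (fst z) = row_functional h u0" "expand z = rs"
      using r1[OF rs(1)] by blast
    moreover have "pair_norm (rs - pq) \<le> s + 1 / real (Suc i)"
      using rs(2) pair_norm_minus_commute[of rs pq] by (simp add: \<eta>_def)
    ultimately show ?thesis by blast
  qed
  then obtain zs where zs: "\<And>i. zs i \<in> T" "\<And>i. triple_norm (zs i - z0) < \<rho>"
    "\<And>i. row_functional h (fst (zs i)) = row_functional h u0"
    "\<And>i. pair_norm (expand (zs i) - pq) \<le> s + 1 / real (Suc i)"
    by metis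
  have bd: "triple_norm (zs i) \<le> triple_norm z0 + \<rho>" for i
    using triple_norm_triangle[of "zs i - z0" z0] zs(2)[of i] by simp
  obtain \<sigma> z where \<sigma>: "strict_mono \<sigma>" and zT: "z \<in> T"
    and lim: "(\<lambda>i. triple_norm (zs (\<sigma> i) - z)) \<longlonglongrightarrow> 0"
    using bounded_triples_subseq[of zs, OF zs(1) bd] by blast
  have lim': "(\<lambda>i. pair_norm (expand (zs (\<sigma> i)) - expand z)) \<longlonglongrightarrow> 0"
  proof (rule LIMSEQ_null_comparison)
    show "norm (pair_norm (expand (zs (\<sigma> i)) - expand z)) \<le>
        K * (triple_norm z + triple_norm (zs (\<sigma> i) - z)) * triple_norm (zs (\<sigma> i) - z)" for i
      using pair_norm_expand_diff_le[OF zs(1) zT] by simp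
    have "(\<lambda>i. K * (triple_norm z + triple_norm (zs (\<sigma> i) - z)) * triple_norm (zs (\<sigma> i) - z))
        \<longlonglongrightarrow> K * (triple_norm z + 0) * 0"
      by (intro tendsto_intros lim)
    then show "(\<lambda>i. K * (triple_norm z + triple_norm (zs (\<sigma> i) - z)) * triple_norm (zs (\<sigma> i) - z)) \<longlonglongrightarrow> 0"
      by simp
  qed
  have z_ball: "triple_norm (z - z0) \<le> \<rho>"
  proof (rule LIMSEQ_le_const[of "\<lambda>i. triple_norm (zs (\<sigma> i) - z) + \<rho>"])
    show "(\<lambda>i. triple_norm (zs (\<sigma> i) - z) + \<rho>) \<longlonglongrightarrow> \<rho>"
      using tendsto_add[OF lim tendsto_const[of \<rho>]] by simp
    have "triple_norm (z - z0) \<le> triple_norm (zs (\<sigma> i) - z) + \<rho>" for i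
      using triple_norm_diff_triangle[of z z0 "zs (\<sigma> i)"] zs(2)[of "\<sigma> i"]
        triple_norm_minus_commute[of z "zs (\<sigma> i)"] by linarith
    then show "\<exists>N. \<forall>i\<ge>N. triple_norm (z - z0) \<le> triple_norm (zs (\<sigma> i) - z) + \<rho>"
      by blast
  qed
  have z_row: "row_functional h (fst z) = row_functional h u0"
  proof -
    have "(\<lambda>i. poly_norm (fst (zs (\<sigma> i)) - fst z)) \<longlonglongrightarrow> 0"
    proof (rule LIMSEQ_null_comparison[OF _ lim])
      show "norm (poly_norm (fst (zs (\<sigma> i)) - fst z)) \<le> triple_norm (zs (\<sigma> i) - z)" for i
        using poly_norm_fst_le_triple_norm[of "zs (\<sigma> i) - z"] by simp
    qed
    then have "(\<lambda>i. row_functional h (fst (zs (\<sigma> i)))) \<longlonglongrightarrow> row_functional h (fst z)"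
      by (intro row_functional_tendsto coeffs_tendsto_if_poly_norm)
    then show ?thesis by (simp add: zs(3) LIMSEQ_const_iff)
  qed
  have z_near: "pair_norm (expand z - pq) = s"
  proof (rule antisym[OF _ s_low[OF zT z_ball]])
    show "pair_norm (expand z - pq) \<le> s"
    proof (rule LIMSEQ_le_const[of "\<lambda>i. pair_norm (expand (zs (\<sigma> i)) - expand z) + (s + 1 / real (Suc (\<sigma> i)))"])
      from LIMSEQ_subseq_LIMSEQ[OF LIMSEQ_one_over_Suc \<sigma>]
      have "(\<lambda>i. 1 / real (Suc (\<sigma> i))) \<longlonglongrightarrow> 0" by (simp add: o_def)
      then have "(\<lambda>i. pair_norm (expand (zs (\<sigma> i)) - expand z) + (s + 1 / real (Suc (\<sigma> i)))) \<longlonglongrightarrow> 0 + (s + 0)"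
        by (intro tendsto_intros lim')
      then show "(\<lambda>i. pair_norm (expand (zs (\<sigma> i)) - expand z) + (s + 1 / real (Suc (\<sigma> i)))) \<longlonglongrightarrow> s"
        by simp
      have "pair_norm (expand z - pq) \<le> pair_norm (expand (zs (\<sigma> i)) - expand z) + (s + 1 / real (Suc (\<sigma> i)))" for i
        using pair_norm_diff_triangle[of "expand z" pq "expand (zs (\<sigma> i))"] zs(4)[of "\<sigma> i"]
          pair_norm_minus_commute[of "expand z" "expand (zs (\<sigma> i))"] by linarith
      then show "\<exists>N. \<forall>i\<ge>N. pair_norm (expand z - pq) \<le> pair_norm (expand (zs (\<sigma> i)) - expand z) + (s + 1 / real (Suc (\<sigma> i)))"
        by blast
    qed
  qed
  show ?thesis using zT z_ball z_row z_near unfolding s_def by blast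
qed

text \<open>The midpoint of two factorizations of nearest pairs is a factorization of a third pair.  By Stewart's
  identity, that pair would be closer by an amount quadratic in the distance \<open>g\<close> of the two nearest
  pairs, up to a curvature term \<open>e = O(g\<^sup>2)\<close> that enters multiplied by the small distance \<open>s\<close>.
  With the bound \<open>1/16\<close> the curvature contributes at most \<open>(1/8 + 1/64) g\<^sup>2\<close>, less than the gain \<open>g\<^sup>2 / 4\<close>.\<close>

lemma nearest_pair_unique:
  assumes \<rho>: "admissible_radius \<rho>"
    and y: "y \<in> T" "triple_norm (y - z0) \<le> \<rho>" and z: "z \<in> T" "triple_norm (z - z0) \<le> \<rho>"
    and row: "row_functional h (fst y) = row_functional h (fst z)"
    and near: "pair_norm (expand y - pq) = gcd_dist m n k pq" "pair_norm (expand z - pq) = gcd_dist m n k pq"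
    and small: "gcd_dist m n k pq * (K * \<kappa>\<^sup>2) \<le> 1 / 16"
  shows "expand y = expand z"
proof -
  define s where "s = gcd_dist m n k pq"
  define E where "E = K * \<kappa>\<^sup>2"
  have E: "E > 0" using K_pos \<kappa>_pos by (simp add: E_def)
  have s0: "0 \<le> s" by (simp add: s_def gcd_dist_nonneg)
  note near = near[folded s_def] and small = small[folded s_def E_def]
  define g where "g = pair_norm (expand y - expand z)"
  define e where "e = pair_norm (expand (y - z)) / 4"
  define A where "A = pair_norm (pair_scale (1 - 1/2) (expand y - pq) + pair_scale (1/2) (expand z - pq))"
  have "g = pair_norm ((expand y - pq) - (expand z - pq))" by (simp add: g_def)
  also have "\<dots> \<le> 2 * s"
    using pair_norm_diff_le[of "expand y - pq" "expand z - pq"] near by simp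
  finally have g: "0 \<le> g" "g \<le> 2 * s" by (simp_all add: g_def)
  have A2: "A\<^sup>2 = s\<^sup>2 - g\<^sup>2 / 4"
    unfolding A_def pair_norm_Stewart using near by (simp add: g_def power2_eq_square field_simps)
  have "triple_norm (y - z) \<le> 2 * \<kappa> * g"
    unfolding g_def by (rule expand_inverse_lipschitz[OF y(1) z(1) y(2) z(2) row radius_small[OF \<rho>]])
  then have "(triple_norm (y - z))\<^sup>2 \<le> (2 * \<kappa> * g)\<^sup>2"
    by (intro power_mono) auto
  then have "K * (triple_norm (y - z))\<^sup>2 \<le> K * (2 * \<kappa> * g)\<^sup>2"
    using K_pos by simp
  then have e: "e \<le> E * g\<^sup>2"
    using pair_norm_expand_le_K[OF triples_upto_diff[OF y(1) z(1)]]
    by (simp add: e_def E_def power_mult_distrib)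
  let ?mid = "triple_scale (1 - 1/2) y + triple_scale (1/2) z"
  have "?mid \<in> T" using y(1) z(1) by (intro triples_upto_add triples_upto_scale)
  moreover have "triple_norm (?mid - z0) \<le> \<rho>"
    using y(2) z(2) by (intro triple_norm_segment_le) auto
  ultimately have "s \<le> pair_norm (expand ?mid - pq)"
    unfolding s_def by (rule gcd_dist_le_expand[OF \<rho>])
  also have "\<dots> \<le> A + e"
    unfolding expand_segment A_def e_def
    using pair_norm_diff_le[of _ "pair_scale (1/2 * (1 - 1/2)) (expand (y - z))"]
    by (simp add: pair_norm_scale)
  finally have "s \<le> A + e" .
  then have "s\<^sup>2 \<le> (A + e)\<^sup>2" using s0 by (intro power_mono)
  also have "\<dots> = A\<^sup>2 + 2 * A * e + e\<^sup>2" by (simp add: power2_sum)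
  finally have 1: "g\<^sup>2 / 4 \<le> 2 * A * e + e\<^sup>2" by (simp add: A2)
  have "A\<^sup>2 \<le> s\<^sup>2" by (simp add: A2)
  then have "A \<le> s" using s0 by (rule power2_le_imp_le)
  have e0: "0 \<le> e" by (simp add: e_def)
  have "A * e \<le> s * (E * g\<^sup>2)"
    using \<open>A \<le> s\<close> e e0 s0 by (intro mult_mono) auto
  also have "\<dots> \<le> 1 / 16 * g\<^sup>2"
    using small mult_right_mono[of "s * E" "1/16" "g\<^sup>2"] by (simp add: mult.assoc)
  finally have 2: "2 * A * e \<le> g\<^sup>2 / 8" by simp
  have "E * g \<le> E * (2 * s)" using g(2) E by simp
  then have Eg: "E * g \<le> 1 / 8" using small by (simp add: mult.commute)
  have "e \<le> (E * g) * g" using e by (simp add: power2_eq_square mult.assoc)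
  also have "\<dots> \<le> 1 / 8 * g" using Eg g(1) by (intro mult_right_mono)
  finally have "e\<^sup>2 \<le> (1 / 8 * g)\<^sup>2" using e0 by (intro power_mono)
  with 1 2 have "g\<^sup>2 \<le> 0" by (simp add: power2_eq_square)
  then have "g = 0" by simp
  then show ?thesis by (simp add: g_def)
qed

text \<open>The constant of the second-order term in the sensitivity estimate.\<close>

definition C :: real where "C = 32 * K * \<kappa>\<^sup>2"

lemma C_pos: "0 < C"
  using K_pos \<kappa>_pos by (simp add: C_def)

text \<open>Bounding the distance of the nearest pair to \<open>pq0\<close> by the triangle inequality would cost a factor 2.
  The nearest pair is almost an orthogonal projection, so its distance to \<open>pq0\<close> is at most that of
  \<open>pq\<close> up to second order; this is the comparison along the segment from \<open>z\<close> to the centre.  The crude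
  factor 2 is only used to bound the second-order terms.\<close>

lemma nearest_pair_sensitivity:
  assumes \<rho>: "admissible_radius \<rho>" and z: "z \<in> T" "triple_norm (z - z0) \<le> \<rho>"
    and row: "row_functional h (fst z) = row_functional h u0"
    and near: "pair_norm (expand z - pq) = gcd_dist m n k pq"
  shows "triple_norm (z - z0) \<le> \<kappa> * pair_norm (pq - pq0) * (1 + C * pair_norm (pq - pq0))"
proof -
  define \<delta> where "\<delta> = pair_norm (pq - pq0)"
  define s where "s = gcd_dist m n k pq"
  have \<delta>0: "0 \<le> \<delta>" by (simp add: \<delta>_def)
  have s0: "0 \<le> s" by (simp add: s_def gcd_dist_nonneg)
  have s_le: "s \<le> \<delta>" unfolding s_def \<delta>_def using gcd_dist_le[OF pq0] .
  note near = near[folded s_def]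
  define G where "G = pair_norm (expand z - pq0)"
  define q where "q = pair_norm (expand (z - z0))"
  define d where "d = triple_norm (z - z0)"
  have q0: "0 \<le> q" and d0: "0 \<le> d" by (simp_all add: q_def d_def)
  have "G\<^sup>2 \<le> \<delta>\<^sup>2 + q\<^sup>2"
  proof (rule le_sum_squares_from_segments[OF _ s0])
    fix t :: real assume t: "0 < t" "t < 1"
    define A where "A = pair_norm (pair_scale (1 - t) (expand z - pq) + pair_scale t (expand z0 - pq))"
    let ?zt = "triple_scale (1 - t) z + triple_scale t z0"
    have "?zt \<in> T" using z(1) z0_in by (intro triples_upto_add triples_upto_scale)
    moreover have "triple_norm (?zt - z0) \<le> \<rho>"
      using z(2) t radius_pos[OF \<rho>] by (intro triple_norm_segment_le) auto
    ultimately have "s \<le> pair_norm (expand ?zt - pq)"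
      unfolding s_def by (rule gcd_dist_le_expand[OF \<rho>])
    also have "\<dots> \<le> A + t * (1 - t) * q"
      unfolding expand_segment A_def q_def
      using pair_norm_diff_le[of _ "pair_scale (t * (1 - t)) (expand (z - z0))"] t
      by (simp add: pair_norm_scale abs_mult)
    finally have "s \<le> A + t * (1 - t) * q" .
    moreover have "A\<^sup>2 = (1 - t) * s\<^sup>2 + t * \<delta>\<^sup>2 - t * (1 - t) * G\<^sup>2"
      unfolding A_def pair_norm_Stewart expand_z0
      by (simp add: near \<delta>_def G_def pair_norm_minus_commute[of pq0 pq])
    moreover have "0 \<le> A" by (simp add: A_def)
    ultimately show "\<exists>A\<ge>0. A\<^sup>2 = (1 - t) * s\<^sup>2 + t * \<delta>\<^sup>2 - t * (1 - t) * G\<^sup>2 \<and> s \<le> A + t * (1 - t) * q"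
      by blast
  qed
  also have "\<dots> \<le> (\<delta> + q)\<^sup>2"
    using q0 \<delta>0 by (simp add: power2_sum)
  finally have Gq: "G \<le> \<delta> + q"
    by (rule power2_le_imp_le) (use q0 \<delta>0 in simp)
  have "d \<le> 2 * \<kappa> * G"
    unfolding d_def G_def expand_z0[symmetric]
    using z row radius_pos[OF \<rho>] radius_small[OF \<rho>]
    by (intro expand_inverse_lipschitz[of _ _ \<rho>] z0_in) auto
  also have "G \<le> 2 * \<delta>"
    using pair_norm_diff_triangle[of "expand z" pq0 pq] near s_le by (simp add: G_def \<delta>_def)
  finally have "d \<le> 4 * \<kappa> * \<delta>"
    using \<kappa>_pos by simp
  then have "d\<^sup>2 \<le> (4 * \<kappa> * \<delta>)\<^sup>2"
    using d0 by (intro power_mono)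
  then have "K * d\<^sup>2 \<le> K * (4 * \<kappa> * \<delta>)\<^sup>2"
    using K_pos by simp
  then have q: "q \<le> 16 * K * \<kappa>\<^sup>2 * \<delta>\<^sup>2"
    using pair_norm_expand_le_K[OF triples_upto_diff[OF z(1) z0_in]]
    by (simp add: q_def d_def power_mult_distrib)
  have "expand_deriv z0 (z - z0) = (expand z - pq0) - expand (z - z0)"
    using expand_add[of z0 "z - z0"] expand_z0 by simp
  then have "pair_norm (expand_deriv z0 (z - z0)) \<le> G + q"
    unfolding G_def q_def by (simp only: pair_norm_diff_le)
  moreover have "d \<le> \<kappa> * pair_norm (expand_deriv z0 (z - z0))"
    unfolding d_def using row
    by (intro coercive triples_upto_diff z(1) z0_in) (simp add: row_functional_simps)
  ultimately have "d \<le> \<kappa> * (G + q)"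
    using \<kappa>_pos mult_left_mono[of "pair_norm (expand_deriv z0 (z - z0))" "G + q" \<kappa>] by linarith
  also have "\<dots> \<le> \<kappa> * (\<delta> * (1 + C * \<delta>))"
  proof (intro mult_left_mono)
    have "G + q \<le> \<delta> + 32 * K * \<kappa>\<^sup>2 * \<delta>\<^sup>2" using Gq q by simp
    then show "G + q \<le> \<delta> * (1 + C * \<delta>)" by (simp add: C_def power2_eq_square algebra_simps)
  qed (use \<kappa>_pos in simp)
  finally show ?thesis by (simp add: d_def \<delta>_def mult.assoc)
qed

lemma local_projection:
  "\<exists>r>0. \<forall>pq. pair_norm (pq - pq0) < r \<longrightarrow>
    (\<exists>z\<in>T. expand z \<in> pairs_gcd_degree m n k \<and>
      {rs \<in> pairs_gcd_degree m n k. pair_norm (rs - pq) = gcd_dist m n k pq} = {expand z} \<and>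
      triple_norm (z - z0) \<le> \<kappa> * pair_norm (pq - pq0) * (1 + C * pair_norm (pq - pq0)))"
proof -
  obtain \<rho> where \<rho>: "admissible_radius \<rho>"
    using admissible_radius_exists by blast
  obtain r1 where r1: "r1 > 0" "\<And>rs. rs \<in> pairs_gcd_degree m n k \<Longrightarrow> pair_norm (rs - pq0) < r1 \<Longrightarrow>
      \<exists>z\<in>T. triple_norm (z - z0) < \<rho> \<and> row_functional h (fst z) = row_functional h u0 \<and> expand z = rs"
    using nearby_pairs_factor_nearby[OF radius_pos[OF \<rho>]] by blast
  define E where "E = K * \<kappa>\<^sup>2"
  have E: "E > 0" using K_pos \<kappa>_pos by (simp add: E_def)
  define r where "r = min (r1 / 2) (1 / (16 * E))"
  have "r > 0" using r1(1) E by (simp add: r_def)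
  moreover have "\<exists>z\<in>T. expand z \<in> pairs_gcd_degree m n k \<and>
      {rs \<in> pairs_gcd_degree m n k. pair_norm (rs - pq) = gcd_dist m n k pq} = {expand z} \<and>
      triple_norm (z - z0) \<le> \<kappa> * pair_norm (pq - pq0) * (1 + C * pair_norm (pq - pq0))"
    if close: "pair_norm (pq - pq0) < r" for pq
  proof -
    have close1: "2 * pair_norm (pq - pq0) < r1" using close by (simp add: r_def)
    have s_le: "gcd_dist m n k pq \<le> pair_norm (pq - pq0)" by (rule gcd_dist_le[OF pq0])
    also have "\<dots> \<le> 1 / (16 * E)" using close by (simp add: r_def)
    finally have "gcd_dist m n k pq * E \<le> 1 / (16 * E) * E"
      using E by (intro mult_right_mono) auto
    also have "\<dots> = 1 / 16" using E by simp
    finally have small: "gcd_dist m n k pq * (K * \<kappa>\<^sup>2) \<le> 1 / 16"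
      by (simp add: E_def)
    obtain z where z: "z \<in> T" "triple_norm (z - z0) \<le> \<rho>"
      and row: "row_functional h (fst z) = row_functional h u0"
      and near: "pair_norm (expand z - pq) = gcd_dist m n k pq"
      using nearest_pair_attained[OF \<rho> r1(2) close1] by blast
    have unique: "rs = expand z"
      if rs: "rs \<in> pairs_gcd_degree m n k" "pair_norm (rs - pq) = gcd_dist m n k pq" for rs
    proof -
      have "pair_norm (rs - pq0) \<le> pair_norm (rs - pq) + pair_norm (pq - pq0)"
        by (rule pair_norm_diff_triangle)
      also have "\<dots> < r1" using rs(2) s_le close1 by simp
      finally obtain y where y: "y \<in> T" "triple_norm (y - z0) < \<rho>"
        "row_functional h (fst y) = row_functional h u0" "expand y = rs"
        using r1(2)[OF rs(1)] by blast
      have "expand y = expand z"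
        by (rule nearest_pair_unique[OF \<rho> y(1) _ z _ _ near small]) (use y row rs(2) in simp_all)
      with y(4) show ?thesis by simp
    qed
    have "expand z \<in> pairs_gcd_degree m n k"
      by (rule in_variety[OF \<rho> z])
    moreover have "{rs \<in> pairs_gcd_degree m n k. pair_norm (rs - pq) = gcd_dist m n k pq} = {expand z}"
      using unique calculation near by blast
    moreover have "triple_norm (z - z0) \<le> \<kappa> * pair_norm (pq - pq0) * (1 + C * pair_norm (pq - pq0))"
      by (rule nearest_pair_sensitivity[OF \<rho> z row near])
    ultimately show ?thesis
      using z(1) by blast
  qed
  ultimately show ?thesis by blast
qed

end

section \<open>Injectivity of the matrix \<open>J\<close> for coprime cofactors\<close>

lemma coprime_cofactors:
  assumes "pq \<in> pairs_gcd_degree m n k" "(u, v, w) \<in> gcd_triples pq"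
  shows "coprime v w"
proof -
  note deg = gcd_triples_degrees[OF assms]
  have pq: "pq = (u * v, u * w)" using assms(2) by (auto simp: gcd_triples_def)
  have "degree (gcd (u * v) (u * w)) = k"
    using assms(1) unfolding pq pairs_gcd_degree_iff by blast
  moreover have "degree (u * gcd v w) \<le> degree (gcd (u * v) (u * w))"
    using deg by (intro dvd_imp_degree_le gcd_greatest mult_dvd_mono) auto
  ultimately have "degree (gcd v w) = 0"
    using deg by (simp add: degree_mult_eq)
  then have "is_unit (gcd v w)"
    using deg by (simp add: is_unit_iff_degree)
  then show ?thesis by (simp only: is_unit_gcd)
qed

text \<open>A kernel vector \<open>(a, b, c)\<close> satisfies \<open>u b + v a = 0\<close> and \<open>u c + w a = 0\<close>.  As the cofactors are
  coprime, \<open>u\<close> divides \<open>a\<close>, and \<open>a\<close> is a constant multiple of \<open>u\<close> for reasons of degree.  With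
  \<open>h\<close> the coefficient vector of \<open>u\<close> the first row turns that constant into 0.\<close>

lemma J_mat_injective:
  assumes pq: "pq \<in> pairs_gcd_degree m n k" and triple: "(u, v, w) \<in> gcd_triples pq"
  shows "mat_injective (J_mat m n k (coeff_vec k u) u v w)"
proof -
  note deg = gcd_triples_degrees[OF pq triple]
  have kmn: "k \<le> m" "k \<le> n" using pairs_gcd_degree_bound[OF pq] by auto
  have z: "(u, v, w) \<in> triples_upto m n k" using deg by (simp add: triples_upto_def)
  let ?J = "J_mat m n k (coeff_vec k u) u v w"
  show ?thesis
    unfolding mat_injective_iff_kernel[OF J_mat_carrier[OF kmn coeff_vec_carrier]]
  proof (intro ballI impI)
    fix x assume x: "x \<in> carrier_vec ((k + 1) + ((m - k + 1) + (n - k + 1)))"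
      and Jx: "?J *\<^sub>v x = 0\<^sub>v (1 + ((m + 1) + (n + 1)))"
    obtain y where y: "y \<in> triples_upto m n k" "x = triple_vec m n k y"
      using triple_vec_surj[OF x] by blast
    obtain a b c where abc: "y = (a, b, c)" by (cases y)
    have "euclid_norm (?J *\<^sub>v x) = 0"
      using Jx by (simp add: euclid_norm_def)
    then have row: "row_functional (coeff_vec k u) a = 0" and der: "expand_deriv (u, v, w) y = 0"
      unfolding y(2) euclid_norm_J_mat[OF kmn coeff_vec_carrier z y(1)]
      by (auto simp: abc sum_power2_eq_zero_iff)
    from der have eqs: "u * b + v * a = 0" "u * c + w * a = 0"
      by (auto simp: abc expand_deriv_def zero_prod_def)
    then have "v * a = u * (- b)" "w * a = u * (- c)"
      by (simp_all add: eq_neg_iff_add_eq_0 add.commute)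
    then have "u dvd a * v" "u dvd a * w"
      by (metis dvd_triv_left mult.commute)+
    then have "u dvd gcd (a * v) (a * w)" by (rule gcd_greatest)
    then have "u dvd a"
      using coprime_cofactors[OF pq triple] by (simp add: gcd_mult_left coprime_iff_gcd_eq_1)
    then obtain e where e: "a = u * e" ..
    have "degree e = 0"
    proof (cases "e = 0")
      case False
      then have "degree a = degree u + degree e" using deg by (simp add: e degree_mult_eq)
      then show ?thesis using y(1) deg by (simp add: abc triples_upto_def)
    qed simp
    then obtain s where "e = [:s:]" by (rule degree_eq_zeroE)
    then have a: "a = smult s u" by (simp add: e)
    have "row_functional (coeff_vec k u) u = of_real ((poly_norm u)\<^sup>2)"
      using deg(1) unfolding row_functional_def
      by (simp add: poly_norm_def coeff_vec_def sum_nonneg complex_norm_square mult.commute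
          lessThan_Suc_atMost del: of_real_power)
    with row have "s * of_real ((poly_norm u)\<^sup>2) = 0"
      by (simp add: a row_functional_simps)
    then have "s = 0" using deg by simp
    then have "y = 0" using a eqs deg by (simp add: abc zero_prod_def)
    then have "euclid_norm x = 0"
      using euclid_norm_triple_vec[OF y(1)] by (simp add: y(2))
    then show "x = 0\<^sub>v ((k + 1) + ((m - k + 1) + (n - k + 1)))"
      using euclid_norm_eq_0_iff[OF x] by simp
  qed
qed

lemma regular_factorization_coeff_vec:
  assumes "pq \<in> pairs_gcd_degree m n k" "(u, v, w) \<in> gcd_triples pq"
  shows "regular_factorization m n k (coeff_vec k u) pq u v w"
  by (rule regular_factorization.intro[OF assms coeff_vec_carrier J_mat_injective[OF assms]])

section \<open>Numerical GCDs near an exact pair\<close>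

lemma eventually_pair_atI:
  assumes "r > 0"
    "\<And>pq. pq \<in> pairs_upto m n \<Longrightarrow> 0 < pair_norm (pq - pq0) \<Longrightarrow> pair_norm (pq - pq0) < r \<Longrightarrow> P pq"
  shows "\<forall>\<^sub>F pq in pair_at m n pq0. P pq"
  unfolding pair_at_def using assms
  by (intro eventually_INF1[of r]) (auto simp: eventually_principal)

definition higher_degrees_far :: "nat \<Rightarrow> nat \<Rightarrow> nat \<Rightarrow> cpoly \<times> cpoly \<Rightarrow> real \<Rightarrow> bool" where
  "higher_degrees_far m n k pq0 r \<longleftrightarrow> (\<forall>j>k. \<forall>rs\<in>pairs_gcd_degree m n j. r \<le> pair_norm (rs - pq0))"

text \<open>The degree \<open>k\<close> itself is within \<open>\<epsilon>\<close> because \<open>pq0\<close> is, and each higher degree is out of reach because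
  \<open>pq\<close> and \<open>\<epsilon>\<close> stay below half of its distance to \<open>pq0\<close>.\<close>

lemma num_gcd_degree_eq:
  assumes pq0: "pq0 \<in> pairs_gcd_degree m n k"
    and far: "higher_degrees_far m n k pq0 (2 * \<theta>)"
    and \<epsilon>: "pair_norm (pq - pq0) < \<epsilon>" "\<epsilon> < \<theta>"
  shows "num_gcd_degree m n \<epsilon> pq = k"
  unfolding num_gcd_degree_def
proof (rule Max_eqI)
  show "finite {j. j \<le> min m n \<and> gcd_dist m n j pq < \<epsilon>}" by simp
  show "k \<in> {j. j \<le> min m n \<and> gcd_dist m n j pq < \<epsilon>}"
    using pairs_gcd_degree_bound[OF pq0] gcd_dist_le[OF pq0, of pq] \<epsilon> by simp
  fix j assume j: "j \<in> {j. j \<le> min m n \<and> gcd_dist m n j pq < \<epsilon>}"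
  show "j \<le> k"
  proof (rule ccontr)
    assume "\<not> j \<le> k"
    have "\<theta> \<le> gcd_dist m n j pq"
      unfolding gcd_dist_def
    proof (rule cINF_greatest)
      show "pairs_gcd_degree m n j \<noteq> {}" using j by (intro pairs_gcd_degree_nonempty) auto
      fix rs assume "rs \<in> pairs_gcd_degree m n j"
      then have "2 * \<theta> \<le> pair_norm (rs - pq0)" 
        using far \<open>\<not> j \<le> k\<close> unfolding higher_degrees_far_def by (meson not_le)
      also have "\<dots> \<le> pair_norm (pq - rs) + pair_norm (pq - pq0)"
        using pair_norm_diff_triangle[of rs pq0 pq] pair_norm_minus_commute[of rs pq] by simp
      finally show "\<theta> \<le> pair_norm (pq - rs)" using \<epsilon> by simp
    qed
    with j \<epsilon> show False by simp
  qed
qed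

text \<open>The last conjunct identifies the product of the triple as the unique nearest pair; the first one
  then makes the triple a numerical GCD with its cofactor pair.\<close>

definition nearest_factorization ::
    "nat \<Rightarrow> nat \<Rightarrow> nat \<Rightarrow> real \<Rightarrow> cpoly \<times> cpoly \<Rightarrow> cpoly \<times> cpoly \<times> cpoly \<Rightarrow> bool" where
  "nearest_factorization m n k \<epsilon> pq z \<longleftrightarrow> z \<in> gcd_triples (expand z) \<and>
     expand z \<in> pairs_gcd_degree m n k \<and> nearest_pairs m n \<epsilon> pq = {expand z}"

lemma nearest_factorization_triple:
  "nearest_factorization m n k \<epsilon> pq z \<Longrightarrow> z \<in> num_gcd_triples m n \<epsilon> pq"
  by (simp add: nearest_factorization_def num_gcd_triples_def)

lemma nearest_factorization_class:
  assumes "nearest_factorization m n k \<epsilon> pq z"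
  shows "num_gcds m n \<epsilon> pq = {u. u \<sim>\<^sub>p fst z}" "class_has_degree (num_gcds m n \<epsilon> pq) k"
    "fst z \<in> num_gcds m n \<epsilon> pq"
proof -
  have eq: "num_gcds m n \<epsilon> pq = gcds (expand z)"
    using assms by (simp add: nearest_factorization_def num_gcds_def)
  show "fst z \<in> num_gcds m n \<epsilon> pq"
    using assms unfolding eq by (cases z) (auto simp: nearest_factorization_def gcd_triples_def)
  moreover have "fst (expand z) \<noteq> 0"
    using assms by (cases "expand z") (auto simp: nearest_factorization_def pairs_gcd_degree_iff)
  ultimately show "num_gcds m n \<epsilon> pq = {u. u \<sim>\<^sub>p fst z}"
    unfolding eq by (rule gcds_eq_class_of_member)
  show "class_has_degree (num_gcds m n \<epsilon> pq) k"
    using assms unfolding eq by (simp add: nearest_factorization_def pairs_gcd_degree_def)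
qed

context regular_factorization
begin

lemma nearest_factorization_near:
  assumes far: "higher_degrees_far m n k pq0 (2 * \<theta>)"
  obtains r where "r > 0" "\<And>pq \<epsilon>. pair_norm (pq - pq0) < r \<Longrightarrow> pair_norm (pq - pq0) < \<epsilon> \<Longrightarrow> \<epsilon> < \<theta> \<Longrightarrow>
      \<exists>z. nearest_factorization m n k \<epsilon> pq z \<and>
        triple_norm (z - z0) \<le> \<kappa> * pair_norm (pq - pq0) * (1 + C * pair_norm (pq - pq0))"
proof -
  obtain r where r: "r > 0" "\<And>pq. pair_norm (pq - pq0) < r \<Longrightarrow>
    (\<exists>z\<in>T. expand z \<in> pairs_gcd_degree m n k \<and>
      {rs \<in> pairs_gcd_degree m n k. pair_norm (rs - pq) = gcd_dist m n k pq} = {expand z} \<and>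
      triple_norm (z - z0) \<le> \<kappa> * pair_norm (pq - pq0) * (1 + C * pair_norm (pq - pq0)))"
    using local_projection by blast
  show ?thesis
  proof (rule that[OF r(1)])
    fix pq \<epsilon> assume *: "pair_norm (pq - pq0) < r" "pair_norm (pq - pq0) < \<epsilon>" "\<epsilon> < \<theta>"
    from r(2)[OF *(1)] obtain z where z: "z \<in> T" "expand z \<in> pairs_gcd_degree m n k"
      "{rs \<in> pairs_gcd_degree m n k. pair_norm (rs - pq) = gcd_dist m n k pq} = {expand z}"
      "triple_norm (z - z0) \<le> \<kappa> * pair_norm (pq - pq0) * (1 + C * pair_norm (pq - pq0))"
      by blast
    obtain u v w where uvw: "z = (u, v, w)" by (cases z)
    have deg: "degree u \<le> k" "degree v \<le> m - k" using z(1) by (auto simp: uvw triples_upto_def)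
    have "degree (u * v) = m" "u * v \<noteq> 0"
      using z(2) by (auto simp: uvw expand_def pairs_gcd_degree_iff)
    then have "degree u = k"
      using deg k_le by (simp add: degree_mult_eq)
    with z(2) have "z \<in> gcd_triples (expand z)"
      using gcd_triples_intro by (simp add: uvw expand_def)
    moreover have "nearest_pairs m n \<epsilon> pq = {expand z}"
      using z(3) num_gcd_degree_eq[OF pq0 far *(2,3)] by (simp add: nearest_pairs_def Let_def)
    ultimately have "nearest_factorization m n k \<epsilon> pq z"
      using z(2) by (simp add: nearest_factorization_def)
    then show "\<exists>z. nearest_factorization m n k \<epsilon> pq z \<and>
        triple_norm (z - z0) \<le> \<kappa> * pair_norm (pq - pq0) * (1 + C * pair_norm (pq - pq0))"
      using z(4) by blast
  qed
qed

lemma nearest_factorization_near_linear: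
  assumes far: "higher_degrees_far m n k pq0 (2 * \<theta>)"
  obtains r where "r > 0" "\<And>pq \<epsilon>. pair_norm (pq - pq0) < r \<Longrightarrow> pair_norm (pq - pq0) < \<epsilon> \<Longrightarrow> \<epsilon> < \<theta> \<Longrightarrow>
      \<exists>z. nearest_factorization m n k \<epsilon> pq z \<and>
        triple_norm (z - z0) \<le> \<kappa> * (1 + C) * pair_norm (pq - pq0)"
proof -
  obtain r where r: "r > 0" "\<And>pq \<epsilon>. pair_norm (pq - pq0) < r \<Longrightarrow> pair_norm (pq - pq0) < \<epsilon> \<Longrightarrow> \<epsilon> < \<theta> \<Longrightarrow>
      \<exists>z. nearest_factorization m n k \<epsilon> pq z \<and>
        triple_norm (z - z0) \<le> \<kappa> * pair_norm (pq - pq0) * (1 + C * pair_norm (pq - pq0))"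
    using nearest_factorization_near[OF far] by blast
  show ?thesis
  proof (rule that[of "min r 1"])
    show "min r 1 > 0" using r by simp
    fix pq \<epsilon> assume *: "pair_norm (pq - pq0) < min r 1" "pair_norm (pq - pq0) < \<epsilon>" "\<epsilon> < \<theta>"
    have "\<kappa> * pair_norm (pq - pq0) * (1 + C * pair_norm (pq - pq0)) \<le> \<kappa> * pair_norm (pq - pq0) * (1 + C * 1)"
      using \<kappa>_pos C_pos *(1) by (intro mult_left_mono add_left_mono) auto
    also have "\<dots> = \<kappa> * (1 + C) * pair_norm (pq - pq0)" by (simp add: algebra_simps)
    finally show "\<exists>z. nearest_factorization m n k \<epsilon> pq z \<and>
        triple_norm (z - z0) \<le> \<kappa> * (1 + C) * pair_norm (pq - pq0)"
      using r(2)[of pq \<epsilon>] * by (meson min_less_iff_conj order_trans)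
  qed
qed

lemma poly_norm_fst_diff_le: "poly_norm (fst z - u0) \<le> triple_norm (z - z0)"
  using poly_norm_fst_le_triple_norm[of "z - z0"] by simp

text \<open>A selected GCD is a scalar multiple \<open>a u\<close> of the representative \<open>u\<close> close to \<open>u0\<close>.  The bound on the
  selection bounds \<open>a\<close>, because the norm of \<open>u\<close> is at least half of that of \<open>u0\<close>, and \<open>a u0\<close> is an
  exact GCD at distance \<open>\<bar>a\<bar> \<parallel>u - u0\<parallel>\<close>.\<close>

lemma num_gcd_selection_accuracy:
  assumes far: "higher_degrees_far m n k pq0 (2 * \<theta>)"
    and \<epsilon>: "0 < \<epsilon>" "\<epsilon> < \<theta>"
    and U: "\<forall>\<^sub>F pq in pair_at m n pq0. U pq \<in> num_gcds m n \<epsilon> pq \<and> poly_norm (U pq) \<le> B"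
  shows "solves_num_gcd_problem m n pq0 U"
proof -
  obtain r where r: "r > 0" "\<And>pq \<epsilon>. pair_norm (pq - pq0) < r \<Longrightarrow> pair_norm (pq - pq0) < \<epsilon> \<Longrightarrow> \<epsilon> < \<theta> \<Longrightarrow>
      \<exists>z. nearest_factorization m n k \<epsilon> pq z \<and>
        triple_norm (z - z0) \<le> \<kappa> * (1 + C) * pair_norm (pq - pq0)"
    using nearest_factorization_near_linear[OF far] by blast
  define M where "M = \<kappa> * (1 + C)"
  have M: "M > 0" using \<kappa>_pos C_pos by (simp add: M_def)
  have u0: "u0 \<noteq> 0" "u0 \<in> gcds pq0"
    using gcd_triples_degrees[OF pq0 triple] triple by (auto simp: gcd_triples_def)
  then have n0: "poly_norm u0 > 0" by (simp add: less_le)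
  have fst_pq0: "fst pq0 \<noteq> 0" using pq0 by (cases pq0) (auto simp: pairs_gcd_degree_iff)
  define c where "c = 2 * B / poly_norm u0 * M"
  have main: "\<forall>\<^sub>F pq in pair_at m n pq0. degree (U pq) = k \<and>
      norm (INF u0 \<in> gcds pq0. poly_norm (U pq - u0)) \<le> c * norm (pair_norm (pq - pq0))"
  proof (rule eventually_mp[OF eventually_pair_atI U])
    show "min r (min \<epsilon> (poly_norm u0 / (2 * M))) > 0"
      using r(1) \<epsilon>(1) n0 M by simp
    fix pq assume small: "pair_norm (pq - pq0) < min r (min \<epsilon> (poly_norm u0 / (2 * M)))"
    show "U pq \<in> num_gcds m n \<epsilon> pq \<and> poly_norm (U pq) \<le> B \<longrightarrow> degree (U pq) = k \<and>
      norm (INF u0 \<in> gcds pq0. poly_norm (U pq - u0)) \<le> c * norm (pair_norm (pq - pq0))"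
    proof (intro impI, elim conjE)
      assume Upq: "U pq \<in> num_gcds m n \<epsilon> pq" "poly_norm (U pq) \<le> B"
      let ?\<delta> = "pair_norm (pq - pq0)"
      obtain z where z: "nearest_factorization m n k \<epsilon> pq z" "triple_norm (z - z0) \<le> M * ?\<delta>"
        using r(2)[of pq \<epsilon>] small \<epsilon>(2) unfolding M_def by auto
      note cls = nearest_factorization_class[OF z(1)]
      have "U pq \<sim>\<^sub>p fst z"
        using Upq(1) cls(1) by simp
      then obtain a where a: "a \<noteq> 0" "U pq = smult a (fst z)"
        by (auto simp: poly_sim_def)
      have zu: "poly_norm (fst z - u0) \<le> M * ?\<delta>"
        using poly_norm_fst_diff_le z(2) by (rule order_trans)
      have "M * ?\<delta> \<le> M * (poly_norm u0 / (2 * M))"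
        using small M by (intro mult_left_mono) auto
      then have "M * ?\<delta> \<le> poly_norm u0 / 2" using M by simp
      moreover have "poly_norm u0 \<le> poly_norm (fst z) + poly_norm (fst z - u0)"
        using poly_norm_triangle[of "fst z" "u0 - fst z"] poly_norm_uminus[of "fst z - u0"] by simp
      ultimately have "poly_norm u0 / 2 \<le> poly_norm (fst z)" using zu by simp
      then have "cmod a * (poly_norm u0 / 2) \<le> poly_norm (U pq)"
        unfolding a(2) poly_norm_smult by (intro mult_left_mono) auto
      then have "cmod a \<le> 2 * B / poly_norm u0"
        using Upq(2) n0 by (simp add: field_simps)
      have "smult a u0 \<in> gcds pq0"
        using gcds_eq_class_of_member[OF u0(2) fst_pq0] a(1) by (auto simp: poly_sim_def)
      then have "(INF u0 \<in> gcds pq0. poly_norm (U pq - u0)) \<le> poly_norm (U pq - smult a u0)"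
        by (intro cINF_lower bdd_belowI2[of _ 0]) auto
      also have "\<dots> = cmod a * poly_norm (fst z - u0)"
        unfolding a(2) by (simp flip: poly_norm_smult smult_diff_right)
      also have "\<dots> \<le> (2 * B / poly_norm u0) * (M * ?\<delta>)"
        using \<open>cmod a \<le> 2 * B / poly_norm u0\<close> zu by (intro mult_mono) (auto intro: order_trans[OF norm_ge_zero])
      finally have "(INF u0 \<in> gcds pq0. poly_norm (U pq - u0)) \<le> c * ?\<delta>"
        by (simp add: c_def)
      moreover have "0 \<le> (INF u0 \<in> gcds pq0. poly_norm (U pq - u0))"
        using u0(2) by (intro cINF_greatest) auto
      moreover have "degree (U pq) = k"
        using Upq(1) cls(2) by (auto simp: class_has_degree_def)
      ultimately show "degree (U pq) = k \<and>
          norm (INF u0 \<in> gcds pq0. poly_norm (U pq - u0)) \<le> c * norm (pair_norm (pq - pq0))"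
        by simp
    qed
  qed
  have "class_has_degree (gcds pq0) k"
    using pq0 by (simp add: pairs_gcd_degree_def)
  then have "\<forall>\<^sub>F pq in pair_at m n pq0. class_has_degree (gcds pq0) (degree (U pq))"
    by (intro eventually_mono[OF main]) simp
  moreover have "(\<lambda>pq. INF u0 \<in> gcds pq0. poly_norm (U pq - u0)) \<in> O[pair_at m n pq0](\<lambda>pq. pair_norm (pq - pq0))"
    by (rule bigoI[of _ c], rule eventually_mono[OF main]) simp
  ultimately show ?thesis
    unfolding solves_num_gcd_problem_def by blast
qed

lemma num_gcd_selection_converges:
  assumes far: "higher_degrees_far m n k pq0 (2 * \<theta>)"
    and \<epsilon>: "0 < \<epsilon>" "\<epsilon> < \<theta>"
  shows "\<exists>U. (\<forall>\<^sub>F pq in pair_at m n pq0. U pq \<in> num_gcds m n \<epsilon> pq) \<and>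
    ((\<lambda>pq. poly_norm (U pq - u0)) \<longlongrightarrow> 0) (pair_at m n pq0)"
proof -
  define M where "M = \<kappa> * (1 + C)"
  have M: "M > 0" using \<kappa>_pos C_pos by (simp add: M_def)
  obtain r where r: "r > 0" "\<And>pq \<epsilon>. pair_norm (pq - pq0) < r \<Longrightarrow> pair_norm (pq - pq0) < \<epsilon> \<Longrightarrow> \<epsilon> < \<theta> \<Longrightarrow>
      \<exists>z. nearest_factorization m n k \<epsilon> pq z \<and>
        triple_norm (z - z0) \<le> M * pair_norm (pq - pq0)"
    using nearest_factorization_near_linear[OF far] unfolding M_def by blast
  define U where "U pq = (SOME u. u \<in> num_gcds m n \<epsilon> pq \<and> poly_norm (u - u0) \<le> M * pair_norm (pq - pq0))" for pq
  have U: "U pq \<in> num_gcds m n \<epsilon> pq \<and> poly_norm (U pq - u0) \<le> M * pair_norm (pq - pq0)"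
    if small: "pair_norm (pq - pq0) < min r \<epsilon>" for pq
    unfolding U_def
  proof (rule someI_ex)
    obtain z where z: "nearest_factorization m n k \<epsilon> pq z" "triple_norm (z - z0) \<le> M * pair_norm (pq - pq0)"
      using r(2)[of pq \<epsilon>] small \<epsilon>(2) by auto
    have "fst z \<in> num_gcds m n \<epsilon> pq"
      by (rule nearest_factorization_class[OF z(1)])
    moreover have "poly_norm (fst z - u0) \<le> M * pair_norm (pq - pq0)"
      using poly_norm_fst_diff_le z(2) by (rule order_trans)
    ultimately show "\<exists>u. u \<in> num_gcds m n \<epsilon> pq \<and> poly_norm (u - u0) \<le> M * pair_norm (pq - pq0)"
      by blast
  qed
  have "\<forall>\<^sub>F pq in pair_at m n pq0. U pq \<in> num_gcds m n \<epsilon> pq"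
    using r(1) \<epsilon>(1) U by (intro eventually_pair_atI[of "min r \<epsilon>"]) auto
  moreover have "((\<lambda>pq. poly_norm (U pq - u0)) \<longlongrightarrow> 0) (pair_at m n pq0)"
  proof (rule tendstoI)
    fix e :: real assume e: "0 < e"
    show "\<forall>\<^sub>F pq in pair_at m n pq0. dist (poly_norm (U pq - u0)) 0 < e"
    proof (rule eventually_pair_atI)
      show "min (min r \<epsilon>) (e / M) > 0" using r(1) \<epsilon>(1) e M by simp
      fix pq assume *: "pair_norm (pq - pq0) < min (min r \<epsilon>) (e / M)"
      have "M * pair_norm (pq - pq0) < e"
        using * M by (simp add: field_simps)
      with U[of pq] * show "dist (poly_norm (U pq - u0)) 0 < e" by simp
    qed
  qed
  ultimately show ?thesis by blast
qed

text \<open>The factor \<open>1 + C \<delta>\<close> tends to 1, so it only costs an arbitrarily small \<open>e\<close>.\<close>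

lemma num_gcd_sensitivity:
  assumes far: "higher_degrees_far m n k pq0 (2 * \<theta>)"
    and \<epsilon>: "0 < \<epsilon>" "\<epsilon> < \<theta>"
  shows "Limsup (pair_at m n pq0)
      (\<lambda>pq. ereal (Inf {triple_norm ((u, v, w) - (u0, v0, w0)) | u v w u0 v0 w0.
                          (u, v, w) \<in> num_gcd_triples m n \<epsilon> pq \<and>
                          (u0, v0, w0) \<in> gcd_triples pq0}
                   / pair_norm (pq - pq0))) \<le> ereal \<kappa>"
proof (rule ereal_le_epsilon2)
  fix e :: real assume e: "0 < e"
  obtain r where r: "r > 0" "\<And>pq \<epsilon>. pair_norm (pq - pq0) < r \<Longrightarrow> pair_norm (pq - pq0) < \<epsilon> \<Longrightarrow> \<epsilon> < \<theta> \<Longrightarrow>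
      \<exists>z. nearest_factorization m n k \<epsilon> pq z \<and>
        triple_norm (z - z0) \<le> \<kappa> * pair_norm (pq - pq0) * (1 + C * pair_norm (pq - pq0))"
    using nearest_factorization_near[OF far] by blast
  show "Limsup (pair_at m n pq0)
      (\<lambda>pq. ereal (Inf {triple_norm ((u, v, w) - (u0, v0, w0)) | u v w u0 v0 w0.
                          (u, v, w) \<in> num_gcd_triples m n \<epsilon> pq \<and>
                          (u0, v0, w0) \<in> gcd_triples pq0}
                   / pair_norm (pq - pq0))) \<le> ereal \<kappa> + ereal e"
  proof (rule Limsup_bounded, rule eventually_pair_atI)
    show "min (min r \<epsilon>) (e / (\<kappa> * C)) > 0"
      using r(1) \<epsilon>(1) e \<kappa>_pos C_pos by simp
    fix pq assume pos: "0 < pair_norm (pq - pq0)"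
      and small: "pair_norm (pq - pq0) < min (min r \<epsilon>) (e / (\<kappa> * C))"
    let ?\<delta> = "pair_norm (pq - pq0)"
    let ?S = "{triple_norm ((u, v, w) - (u0, v0, w0)) | u v w u0 v0 w0.
                          (u, v, w) \<in> num_gcd_triples m n \<epsilon> pq \<and> (u0, v0, w0) \<in> gcd_triples pq0}"
    obtain z where z: "nearest_factorization m n k \<epsilon> pq z"
      "triple_norm (z - z0) \<le> \<kappa> * ?\<delta> * (1 + C * ?\<delta>)"
      using r(2)[of pq \<epsilon>] small \<epsilon>(2) by auto
    have "z \<in> num_gcd_triples m n \<epsilon> pq"
      by (rule nearest_factorization_triple[OF z(1)])
    then have "triple_norm (z - z0) \<in> ?S"
      using triple by (cases z) blast
    moreover have "bdd_below ?S" by (rule bdd_belowI[of _ 0]) auto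
    ultimately have "Inf ?S \<le> triple_norm (z - z0)" by (rule cInf_lower)
    also have "\<dots> \<le> ?\<delta> * (\<kappa> + \<kappa> * C * ?\<delta>)"
      using z(2) by (simp add: algebra_simps)
    also have "\<dots> \<le> ?\<delta> * (\<kappa> + e)"
    proof (intro mult_left_mono add_left_mono)
      show "\<kappa> * C * ?\<delta> \<le> e" using small \<kappa>_pos C_pos by (simp add: field_simps)
    qed simp
    finally have "Inf ?S / ?\<delta> \<le> \<kappa> + e"
      using pos by (simp add: field_simps)
    then show "ereal (Inf ?S / ?\<delta>) \<le> ereal \<kappa> + ereal e" by simp
  qed
qed

end

theorem corollary6p3:
  fixes m n k :: nat and pq0 :: "complex poly \<times> complex poly"
  assumes "pq0 \<in> pairs_exact m n" and "class_has_degree (gcds pq0) k"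
  shows "\<exists>D \<theta>. D \<subseteq> pairs_exact m n \<and> pair_nbhd m n pq0 D \<and> \<theta> > (0::real) \<and>
    (\<forall>pq\<in>D. \<forall>\<epsilon>\<in>{pair_norm (pq - pq0)<..<\<theta>}.
        num_gcds m n \<epsilon> pq \<noteq> {} \<and>
        (\<forall>u\<in>num_gcds m n \<epsilon> pq. num_gcds m n \<epsilon> pq = {u'. u' \<sim>\<^sub>p u}) \<and>
        class_has_degree (num_gcds m n \<epsilon> pq) k) \<and>
    (\<forall>\<epsilon>\<in>{0<..<\<theta>}.
        (\<forall>U B. (\<forall>\<^sub>F pq in pair_at m n pq0. U pq \<in> num_gcds m n \<epsilon> pq \<and> poly_norm (U pq) \<le> B)
           \<longrightarrow> solves_num_gcd_problem m n pq0 U) \<and>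
        (\<forall>u0\<in>gcds pq0. \<exists>U.
           (\<forall>\<^sub>F pq in pair_at m n pq0. U pq \<in> num_gcds m n \<epsilon> pq) \<and>
           ((\<lambda>pq. poly_norm (U pq - u0)) \<longlongrightarrow> 0) (pair_at m n pq0)) \<and>
        Limsup (pair_at m n pq0)
          (\<lambda>pq. ereal (Inf {triple_norm ((u, v, w) - (u0, v0, w0)) | u v w u0 v0 w0.
                              (u, v, w) \<in> num_gcd_triples m n \<epsilon> pq \<and>
                              (u0, v0, w0) \<in> gcd_triples pq0}
                       / pair_norm (pq - pq0)))
          \<le> Inf {ereal (mat_norm (pseudo_inverse (J_mat m n k h u0 v0 w0))) | h u0 v0 w0.
                   h \<in> carrier_vec (k + 1) \<and> (u0, v0, w0) \<in> gcd_triples pq0 \<and>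
                   mat_injective (J_mat m n k h u0 v0 w0)} \<and>
        Inf {ereal (mat_norm (pseudo_inverse (J_mat m n k h u0 v0 w0))) | h u0 v0 w0.
               h \<in> carrier_vec (k + 1) \<and> (u0, v0, w0) \<in> gcd_triples pq0 \<and>
               mat_injective (J_mat m n k h u0 v0 w0)} < \<infinity>)"
proof -
  have pq0: "pq0 \<in> pairs_gcd_degree m n k"
    using assms by (simp add: pairs_gcd_degree_def)
  obtain u1 v1 w1 where triple1: "(u1, v1, w1) \<in> gcd_triples pq0"
    using gcd_factorization_normalized[OF pq0] by blast
  interpret R1: regular_factorization m n k "coeff_vec k u1" pq0 u1 v1 w1
    by (rule regular_factorization_coeff_vec[OF pq0 triple1])
  obtain r2 where r2: "r2 > 0"
    "\<And>j rs. k < j \<Longrightarrow> rs \<in> pairs_gcd_degree m n j \<Longrightarrow> r2 \<le> pair_norm (rs - pq0)"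
    using gcd_degree_upper_semicontinuous[OF pq0] by blast
  define \<theta> where "\<theta> = r2 / 2"
  have \<theta>: "\<theta> > 0" using r2(1) by (simp add: \<theta>_def)
  have far: "higher_degrees_far m n k pq0 (2 * \<theta>)"
    using r2(2) by (simp add: higher_degrees_far_def \<theta>_def)
  obtain r3 where r3: "r3 > 0"
    "\<And>pq. pq \<in> pairs_upto m n \<Longrightarrow> pair_norm (pq - pq0) < r3 \<Longrightarrow> pq \<in> pairs_exact m n"
    using pairs_exact_open[OF assms(1)] by blast
  obtain r4 where r4: "r4 > 0" "\<And>pq \<epsilon>. pair_norm (pq - pq0) < r4 \<Longrightarrow> pair_norm (pq - pq0) < \<epsilon> \<Longrightarrow> \<epsilon> < \<theta> \<Longrightarrow>
      \<exists>z. nearest_factorization m n k \<epsilon> pq z \<and>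
        triple_norm (z - (u1, v1, w1)) \<le> R1.\<kappa> * (1 + R1.C) * pair_norm (pq - pq0)"
    using R1.nearest_factorization_near_linear[OF far] by blast
  define D where "D = {pq \<in> pairs_upto m n. pair_norm (pq - pq0) < min r3 r4}"
  have D_exact: "D \<subseteq> pairs_exact m n"
    using r3(2) by (auto simp: D_def)
  have D_nbhd: "pair_nbhd m n pq0 D"
    unfolding pair_nbhd_def D_def using r3(1) r4(1) by (intro exI[of _ "min r3 r4"]) auto
  have wellposed: "num_gcds m n \<epsilon> pq \<noteq> {} \<and>
        (\<forall>u\<in>num_gcds m n \<epsilon> pq. num_gcds m n \<epsilon> pq = {u'. u' \<sim>\<^sub>p u}) \<and>
        class_has_degree (num_gcds m n \<epsilon> pq) k"
    if "pq \<in> D" "\<epsilon> \<in> {pair_norm (pq - pq0)<..<\<theta>}" for pq \<epsilon>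
  proof -
    have "pair_norm (pq - pq0) < r4" "pair_norm (pq - pq0) < \<epsilon>" "\<epsilon> < \<theta>"
      using that by (auto simp: D_def)
    from r4(2)[OF this] obtain z where "nearest_factorization m n k \<epsilon> pq z"
      by blast
    note cls = nearest_factorization_class[OF this]
    have "num_gcds m n \<epsilon> pq = {u'. u' \<sim>\<^sub>p u}" if "u \<in> num_gcds m n \<epsilon> pq" for u
      using that poly_sim_trans poly_sim_sym unfolding cls(1) by blast
    with cls show ?thesis by blast
  qed
  have convergence: "\<exists>U. (\<forall>\<^sub>F pq in pair_at m n pq0. U pq \<in> num_gcds m n \<epsilon> pq) \<and>
      ((\<lambda>pq. poly_norm (U pq - u0)) \<longlongrightarrow> 0) (pair_at m n pq0)"
    if \<epsilon>: "\<epsilon> \<in> {0<..<\<theta>}" and u0: "u0 \<in> gcds pq0" for \<epsilon> u0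
  proof -
    obtain v0 w0 where "(u0, v0, w0) \<in> gcd_triples pq0"
      using gcd_triples_exist[OF pq0 u0] by blast
    then interpret R: regular_factorization m n k "coeff_vec k u0" pq0 u0 v0 w0
      by (rule regular_factorization_coeff_vec[OF pq0])
    show ?thesis
      using R.num_gcd_selection_converges[OF far] \<epsilon> by auto
  qed
  let ?bounds = "{ereal (mat_norm (pseudo_inverse (J_mat m n k h u0 v0 w0))) | h u0 v0 w0.
                   h \<in> carrier_vec (k + 1) \<and> (u0, v0, w0) \<in> gcd_triples pq0 \<and>
                   mat_injective (J_mat m n k h u0 v0 w0)}"
  have sensitivity: "Limsup (pair_at m n pq0)
          (\<lambda>pq. ereal (Inf {triple_norm ((u, v, w) - (u0, v0, w0)) | u v w u0 v0 w0.
                              (u, v, w) \<in> num_gcd_triples m n \<epsilon> pq \<and>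
                              (u0, v0, w0) \<in> gcd_triples pq0}
                       / pair_norm (pq - pq0))) \<le> Inf ?bounds"
    if \<epsilon>: "\<epsilon> \<in> {0<..<\<theta>}" for \<epsilon>
  proof (rule Inf_greatest)
    fix b assume "b \<in> ?bounds"
    then obtain h u0 v0 w0 where h: "h \<in> carrier_vec (k + 1)" "(u0, v0, w0) \<in> gcd_triples pq0"
        "mat_injective (J_mat m n k h u0 v0 w0)"
      and b: "b = ereal (mat_norm (pseudo_inverse (J_mat m n k h u0 v0 w0)))"
      by blast
    interpret R: regular_factorization m n k h pq0 u0 v0 w0
      by (rule regular_factorization.intro[OF pq0 h(2,1,3)])
    show "Limsup (pair_at m n pq0)
          (\<lambda>pq. ereal (Inf {triple_norm ((u, v, w) - (u0, v0, w0)) | u v w u0 v0 w0.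
                              (u, v, w) \<in> num_gcd_triples m n \<epsilon> pq \<and>
                              (u0, v0, w0) \<in> gcd_triples pq0}
                       / pair_norm (pq - pq0))) \<le> b"
      unfolding b R.\<kappa>_def[symmetric] using \<epsilon> by (intro R.num_gcd_sensitivity[OF far]) auto
  qed
  have "ereal R1.\<kappa> \<in> ?bounds"
    unfolding R1.\<kappa>_def using R1.h R1.inj triple1 by blast
  then have finite: "Inf ?bounds < \<infinity>"
    by (rule le_less_trans[OF Inf_lower]) simp
  have accuracy: "solves_num_gcd_problem m n pq0 U"
    if "\<epsilon> \<in> {0<..<\<theta>}"
      "\<forall>\<^sub>F pq in pair_at m n pq0. U pq \<in> num_gcds m n \<epsilon> pq \<and> poly_norm (U pq) \<le> B" for \<epsilon> U B
    using R1.num_gcd_selection_accuracy[OF far _ _ that(2)] that(1) by auto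
  show ?thesis
    by (rule exI[of _ D], rule exI[of _ \<theta>], intro conjI ballI allI impI)
       (use D_exact D_nbhd \<theta> wellposed convergence sensitivity finite accuracy in blast)+
qed

end
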